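(* Let $\mathscr D$, $V$ be as in the context, $Q=\operatorname{Im}V$, and for $a\in\mathbb R$ put $\Pi_a=\{\lambda\in\mathbb C:\operatorname{Re}\lambda>a\}$, $\mathscr D_a=\mathscr D\cap\Pi_a$. For a domain $\Omega\subset\mathscr D$ put $$\xi(\Omega)=\sup_{(x,\lambda)\in[0,1]\times\Omega}|Q(x,\lambda)|.$$ Suppose that $\xi(\mathscr D_a)<\infty$ for some $a\in\mathbb R$, and that, in addition, $$(a,+\infty)\times(-\rho,\rho)\subset\mathscr D,\qquad\text{where}\quad \rho=\frac{\xi(\mathscr D_a)}{2-\sqrt3}.$$ Then the spectra $\sigma(H)$, $\sigma(T)$ and $\sigma(\mathcal N)$ in the domain $\mathscr D_{a+\rho}$ are real: $$\mathfrak S\cap\mathscr D_{a+\rho}\subset(a+\rho,+\infty),\qquad \mathfrak S=\sigma(H)\cup\sigma(T)\cup\sigma(\mathcal N).$$ In particular, if the half-plane $\Pi_a\subset\mathscr D$ and $\xi(\Pi_a)<\infty$, then the spectra in the half-plane $\Pi_{a+\rho_1}$ are real: $$\mathfrak S\cap\Pi_{a+\rho_1}\subset(a+\rho_1,+\infty),\qquad \rho_1=\frac{\xi(\Pi_a)}{2-\sqrt3}.$$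
   Context: $\mathscr D\subset\mathbb C$ is a bounded or unbounded domain with piecewise smooth boundary. The potential $V(x,\lambda)$, $x\in\mathbb R$, $\lambda\in\mathscr D$, satisfies: (1) for almost every $x\in\mathbb R$ the function $V(x,\cdot)$ is real analytic in $\mathscr D$ (analytic in $\mathscr D$ and real on $\mathscr D\cap\mathbb R$); (2) for each $\lambda\in\mathscr D$ the function $V(\cdot,\lambda)$ is 1-periodic and $V(\cdot,\lambda)\in L^1(\mathbb T)$, $\mathbb T=\mathbb R/\mathbb Z$. For $\lambda\in\mathscr D$ the following operators act as $y\mapsto -y''+V(\cdot,\lambda)y$: $H(\lambda)$ on $L^2(\mathbb R)$; $T(\lambda)$ on $L^2(0,1)$ with Dirichlet conditions $y(0)=y(1)=0$; $\mathcal N(\lambda)$ on $L^2(0,1)$ with Neumann conditions $y'(0)=y'(1)=0$. For each such operator-valued function $A(\lambda)$, a point $\lambda\in\mathscr D$ is regular if $(A(\lambda)-\lambda)^{-1}$ exists and is bounded; the spectrum $\sigma(A)$ is the complement in $\mathscr D$ of the set of regular points. Subsets of $\mathbb R^2$ are identified with subsets of $\mathbb C$: $A\times B=\{\mu+i\nu:\mu\in A,\nu\in B\}$. *)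

theory Defs
  imports "HOL-Analysis.Analysis"
begin

section \<open>Planar domains with piecewise smooth boundary\<close>

definition smooth_arc :: "(real \<Rightarrow> complex) \<Rightarrow> bool" where
  "smooth_arc g \<longleftrightarrow> arc g \<and> g C1_differentiable_on {0..1} \<and>
     (\<forall>t\<in>{0..1}. vector_derivative g (at t) \<noteq> 0)"

text \<open>
  Local finiteness is what allows unbounded boundaries; corners occur where arcs meet, and the
  boundary may be empty.
\<close>

definition piecewise_smooth_boundary :: "complex set \<Rightarrow> bool" where
  "piecewise_smooth_boundary D \<longleftrightarrow>
     (\<exists>\<A>. frontier D = \<Union>\<A> \<and>
          (\<forall>A\<in>\<A>. \<exists>g. smooth_arc g \<and> path_image g = A) \<and>
          (\<forall>K. compact K \<longrightarrow> finite {A\<in>\<A>. A \<inter> K \<noteq> {}}))"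

section \<open>Square-integrable functions and operators given by their graphs\<close>

text \<open>
  Elements of \<open>L\<^sup>2(I)\<close> are represented by functions on the line whose values off \<open>I\<close> are
  irrelevant; equality in \<open>L\<^sup>2(I)\<close> is \<open>eq_ae I\<close>. An operator in \<open>L\<^sup>2(I)\<close>
  is represented by the set of pairs \<open>(y, f)\<close> of functions representing an element of the domain
  and its image.
\<close>

type_synonym op_graph = "((real \<Rightarrow> complex) \<times> (real \<Rightarrow> complex)) set"

definition L2 :: "real set \<Rightarrow> (real \<Rightarrow> complex) set" where
  "L2 I = {f. set_borel_measurable lebesgue I f \<and>
              set_integrable lebesgue I (\<lambda>x. (cmod (f x))\<^sup>2)}"

definition L2_norm :: "real set \<Rightarrow> (real \<Rightarrow> complex) \<Rightarrow> real" where
  "L2_norm I f = sqrt (LINT x:I|lebesgue. (cmod (f x))\<^sup>2)"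

definition eq_ae :: "real set \<Rightarrow> (real \<Rightarrow> complex) \<Rightarrow> (real \<Rightarrow> complex) \<Rightarrow> bool" where
  "eq_ae I f g \<longleftrightarrow> (AE x in lebesgue. x \<in> I \<longrightarrow> f x = g x)"

definition shift_op :: "op_graph \<Rightarrow> complex \<Rightarrow> op_graph" where
  "shift_op A z = {(y, \<lambda>x. g x - z * y x) | y g. (y, g) \<in> A}"

definition has_bounded_inverse :: "real set \<Rightarrow> op_graph \<Rightarrow> bool" where
  "has_bounded_inverse I B \<longleftrightarrow>
     (\<forall>y1 f1 y2 f2. (y1, f1) \<in> B \<longrightarrow> (y2, f2) \<in> B \<longrightarrow> eq_ae I f1 f2 \<longrightarrow> eq_ae I y1 y2) \<and>
     (\<forall>f\<in>L2 I. \<exists>y. (y, f) \<in> B) \<and>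
     (\<exists>C. \<forall>y f. (y, f) \<in> B \<longrightarrow> L2_norm I y \<le> C * L2_norm I f)"

definition regular_point :: "real set \<Rightarrow> (complex \<Rightarrow> op_graph) \<Rightarrow> complex \<Rightarrow> bool" where
  "regular_point I A l \<longleftrightarrow> has_bounded_inverse I (shift_op (A l) l)"

definition spectrum_in :: "complex set \<Rightarrow> real set \<Rightarrow> (complex \<Rightarrow> op_graph) \<Rightarrow> complex set" where
  "spectrum_in D I A = {l\<in>D. \<not> regular_point I A l}"

section \<open>The operators \<open>y \<mapsto> - y'' + q y\<close>\<close>

text \<open>
  \<open>ac_deriv I y y'\<close>: on the interval \<open>I\<close> the function \<open>y\<close> is locally absolutely continuous (an
  indefinite integral of a locally integrable function) and \<open>y'\<close> is its almost everywhere
  derivative.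
\<close>

definition ac_deriv :: "real set \<Rightarrow> (real \<Rightarrow> complex) \<Rightarrow> (real \<Rightarrow> complex) \<Rightarrow> bool" where
  "ac_deriv I y y' \<longleftrightarrow>
     (\<forall>s\<in>I. \<forall>t\<in>I. s \<le> t \<longrightarrow>
        y' absolutely_integrable_on {s..t} \<and> (y' has_integral (y t - y s)) {s..t})"

text \<open>
  The maximal operator in \<open>L\<^sup>2(I)\<close>, restricted by a boundary condition on \<open>y\<close> and its (locally
  absolutely continuous) derivative \<open>y'\<close>. The bounded interval is taken closed, so that \<open>y\<close> and
  \<open>y'\<close> are absolutely continuous up to the end points and have boundary values.
\<close>

definition schroedinger_op ::
    "real set \<Rightarrow> ((real \<Rightarrow> complex) \<Rightarrow> (real \<Rightarrow> complex) \<Rightarrow> bool) \<Rightarrow> (real \<Rightarrow> complex) \<Rightarrow> op_graph"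
  where
  "schroedinger_op I bc q = {(y, f). y \<in> L2 I \<and> f \<in> L2 I \<and>
     (\<exists>y' y''. ac_deriv I y y' \<and> ac_deriv I y' y'' \<and> bc y y' \<and>
               eq_ae I f (\<lambda>x. - y'' x + q x * y x))}"

definition H_op :: "(real \<Rightarrow> complex \<Rightarrow> complex) \<Rightarrow> complex \<Rightarrow> op_graph" where
  "H_op V l = schroedinger_op UNIV (\<lambda>y y'. True) (\<lambda>x. V x l)"

definition T_op :: "(real \<Rightarrow> complex \<Rightarrow> complex) \<Rightarrow> complex \<Rightarrow> op_graph" where
  "T_op V l = schroedinger_op {0..1} (\<lambda>y y'. y 0 = 0 \<and> y 1 = 0) (\<lambda>x. V x l)"

definition N_op :: "(real \<Rightarrow> complex \<Rightarrow> complex) \<Rightarrow> complex \<Rightarrow> op_graph" where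
  "N_op V l = schroedinger_op {0..1} (\<lambda>y y'. y' 0 = 0 \<and> y' 1 = 0) (\<lambda>x. V x l)"

definition all_spectra :: "complex set \<Rightarrow> (real \<Rightarrow> complex \<Rightarrow> complex) \<Rightarrow> complex set" where
  "all_spectra D V = spectrum_in D UNIV (H_op V) \<union> spectrum_in D {0..1} (T_op V)
                       \<union> spectrum_in D {0..1} (N_op V)"

section \<open>Half-planes, rectangles and the bound on the imaginary part\<close>

definition half_plane :: "real \<Rightarrow> complex set" where
  "half_plane a = {l. Re l > a}"

definition complex_prod :: "real set \<Rightarrow> real set \<Rightarrow> complex set" where
  "complex_prod A B = {Complex m n | m n. m \<in> A \<and> n \<in> B}"

definition xi :: "(real \<Rightarrow> complex \<Rightarrow> complex) \<Rightarrow> complex set \<Rightarrow> ennreal" where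
  "xi V \<Omega> = (SUP (x, l)\<in>{0..1} \<times> \<Omega>. ennreal \<bar>Im (V x l)\<bar>)"

definition rho :: "(real \<Rightarrow> complex \<Rightarrow> complex) \<Rightarrow> complex set \<Rightarrow> real" where
  "rho V \<Omega> = enn2real (xi V \<Omega>) / (2 - sqrt 3)"

end

theory Submission
  imports Defs "HOL-Complex_Analysis.Conformal_Mappings"
begin

text \<open>
  Fix \<open>l\<close> with \<open>\<nu> = Im l \<noteq> 0\<close> and \<open>Re l > a + \<rho>\<close>. For almost every \<open>x\<close> one has
  \<open>\<bar>Im V(x,l)\<bar> \<le> 0.9 \<bar>\<nu>\<bar>\<close>: trivially if \<open>\<bar>\<nu>\<bar>\<close> is comparable with \<open>\<rho>\<close>, and by a Borel-Caratheodory
  estimate on the disc of radius \<open>\<rho>\<close> about \<open>Re l\<close>, where \<open>V(x,\<cdot>)\<close> is real at the centre, otherwise. Hence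
  \<open>p = V(\<cdot>,l) - l\<close> has an imaginary part of constant sign, bounded away from 0, and the imaginary part of
  \<open>\<integral> (- y'' + p y) cnj y\<close> controls \<open>\<integral> \<bar>y\<bar>\<^sup>2\<close> up to boundary terms. On \<open>[0,1]\<close> these terms vanish, so
  \<open>- y'' + p y = f\<close> is uniquely solvable with a bound. On the line, the same identity over one period
  shows that no Floquet multiplier has modulus 1; the monodromy recursion on the values
  \<open>(y(n), y'(n))\<close> is therefore hyperbolic and has a bounded solution for every \<open>f\<close> in \<open>L\<^sup>2\<close>, and the
  energy identity on \<open>[-N,N]\<close> puts the resulting \<open>y\<close> in \<open>L\<^sup>2\<close>.
\<close>

section \<open>Locally absolutely continuous functions\<close>

text \<open>The energy identity is a numerical range bound: it yields injectivity and an estimate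
  for the inverse, but it produces no solutions. On [0,1] these come from shooting, where
  injectivity forces one scalar to be nonzero. On the line no boundary condition cuts down the
  solution space, and y' at distant points is not controlled in advance, so existence and uniqueness
  both go through the period map. As V(.,l) is merely integrable, the equation holds almost
  everywhere only. Product rule, solvability and a priori bounds are therefore proved for absolutely
  continuous functions, and bisection carries them from short intervals to long ones. Constants:
  write X for the value of xi and let \<rho> > 0, so that X = (2 - sqrt 3) \<rho> < 0.27 \<rho>. The
  plain bound gives X < |\<nu>| for |\<nu>| >= 0.27 \<rho>; the disc estimate 2 |\<nu>| X / (\<rho>
  - |\<nu>|) is below |\<nu>| for 0 < |\<nu>| < \<rho> - 2 X, in particular up to 0.46 \<rho>. The
  ranges overlap, and cutting at 0.3 \<rho> gives the factors 0.27 / 0.3 = 0.9 and 0.54 / 0.7 <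
  0.9.\<close>

lemma ac_deriv_mono: "ac_deriv I y y' \<Longrightarrow> J \<subseteq> I \<Longrightarrow> ac_deriv J y y'"
  by (auto simp: ac_deriv_def)

lemma ac_deriv_abs_int: "ac_deriv {a..b} y y' \<Longrightarrow> y' absolutely_integrable_on {a..b}"
  by (cases "a \<le> b") (auto simp: ac_deriv_def)

lemma ac_derivI:
  assumes "y' absolutely_integrable_on {a..b}"
    and "\<And>t. a \<le> t \<Longrightarrow> t \<le> b \<Longrightarrow> y t = y a + integral {a..t} y'"
  shows "ac_deriv {a..b} y y'"
  unfolding ac_deriv_def
proof (intro ballI impI conjI)
  fix s t assume st: "s \<in> {a..b}" "t \<in> {a..b}" "s \<le> t"
  show ai: "y' absolutely_integrable_on {s..t}"
    using st by (intro absolutely_integrable_on_subinterval[OF assms(1)]) auto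
  have "y' absolutely_integrable_on {a..t}"
    using st by (intro absolutely_integrable_on_subinterval[OF assms(1)]) auto
  then have "integral {a..s} y' + integral {s..t} y' = integral {a..t} y'"
    using st by (intro Henstock_Kurzweil_Integration.integral_combine set_lebesgue_integral_eq_integral) auto
  then have "integral {s..t} y' = y t - y s"
    using assms(2)[of s] assms(2)[of t] st by (auto simp: algebra_simps)
  then show "(y' has_integral (y t - y s)) {s..t}"
    using integrable_integral[OF set_lebesgue_integral_eq_integral(1)[OF ai]] by simp
qed

lemma ac_deriv_integral:
  assumes "ac_deriv I y y'" "s \<in> I" "t \<in> I" "s \<le> t"
  shows "integral {s..t} y' = y t - y s"
  using assms by (auto simp: ac_deriv_def intro!: integral_unique)

lemma ac_deriv_continuous:
  assumes "ac_deriv {a..b} y y'"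
  shows "continuous_on {a..b} y"
proof -
  have "continuous_on {a..b} (\<lambda>t. y a + integral {a..t} y')"
    by (intro continuous_intros indefinite_integral_continuous_1
        set_lebesgue_integral_eq_integral ac_deriv_abs_int[OF assms])
  then show ?thesis
    by (rule continuous_on_eq) (use ac_deriv_integral[OF assms] in auto)
qed

lemma ac_deriv_UNIV_iff: "ac_deriv UNIV y y' \<longleftrightarrow> (\<forall>a b. ac_deriv {a..b} y y')"
  unfolding ac_deriv_def
  by (metis UNIV_I atLeastAtMost_iff order_refl)

lemma ac_deriv_linear:
  fixes h :: "complex \<Rightarrow> complex"
  assumes "ac_deriv I y y'" and h: "bounded_linear h"
  shows "ac_deriv I (\<lambda>x. h (y x)) (\<lambda>x. h (y' x))"
  unfolding ac_deriv_def
proof (intro ballI impI conjI)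
  interpret bounded_linear h by fact
  fix s t assume st: "s \<in> I" "t \<in> I" "s \<le> t"
  then have *: "y' absolutely_integrable_on {s..t}" "(y' has_integral (y t - y s)) {s..t}"
    using assms by (auto simp: ac_deriv_def)
  show "(\<lambda>x. h (y' x)) absolutely_integrable_on {s..t}"
    using absolutely_integrable_linear[OF *(1) h] by (simp add: o_def)
  show "((\<lambda>x. h (y' x)) has_integral h (y t) - h (y s)) {s..t}"
    using has_integral_linear[OF *(2) h] by (simp add: o_def diff)
qed

lemma ac_deriv_cmult: "ac_deriv I y y' \<Longrightarrow> ac_deriv I (\<lambda>x. c * y x) (\<lambda>x. c * y' x)"
  using ac_deriv_linear[OF _ bounded_linear_mult_right] .

lemma ac_deriv_cnj: "ac_deriv I y y' \<Longrightarrow> ac_deriv I (\<lambda>x. cnj (y x)) (\<lambda>x. cnj (y' x))"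
  using ac_deriv_linear[OF _ bounded_linear_cnj] .

lemma ac_deriv_add:
  "ac_deriv I y y' \<Longrightarrow> ac_deriv I u u' \<Longrightarrow> ac_deriv I (\<lambda>x. y x + u x) (\<lambda>x. y' x + u' x)"
  unfolding ac_deriv_def add_diff_add
  by (auto intro!: set_integral_add has_integral_add)

lemma ac_deriv_cong_AE:
  assumes "ac_deriv I y y'" "is_interval I" "AE x in lebesgue. x \<in> I \<longrightarrow> u' x = y' x"
  shows "ac_deriv I y u'"
  unfolding ac_deriv_def
proof (intro ballI impI conjI)
  obtain N where "\<And>x. x \<in> space lebesgue - N \<Longrightarrow> x \<in> I \<longrightarrow> u' x = y' x" "N \<in> null_sets lebesgue"
    using AE_E3[OF assms(3)] by blast
  then have N: "negligible N" "\<And>x. x \<notin> N \<Longrightarrow> x \<in> I \<Longrightarrow> u' x = y' x"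
    by (simp_all add: negligible_iff_null_sets)
  fix s t assume st: "s \<in> I" "t \<in> I" "s \<le> t"
  then have *: "y' absolutely_integrable_on {s..t}" "(y' has_integral (y t - y s)) {s..t}"
    using assms(1) by (auto simp: ac_deriv_def)
  have "{s..t} \<subseteq> I"
    using mem_is_interval_1_I[OF assms(2) st(1,2)] by (simp add: subset_iff)
  then have **: "\<And>x. x \<in> {s..t} - N \<Longrightarrow> u' x = y' x" using N by auto
  show "u' absolutely_integrable_on {s..t}"
    by (rule absolutely_integrable_spike[OF *(1) N(1) **])
  show "(u' has_integral y t - y s) {s..t}"
    by (rule has_integral_spike[OF N(1) ** *(2)])
qed

lemma ac_deriv_cong:
  assumes "ac_deriv {a..b} y y'" "\<And>x. a \<le> x \<Longrightarrow> x \<le> b \<Longrightarrow> u x = y x"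
    "\<And>x. a < x \<Longrightarrow> x < b \<Longrightarrow> u' x = y' x"
  shows "ac_deriv {a..b} u u'"
proof -
  have "AE x in lebesgue. x \<noteq> a" "AE x in lebesgue. x \<noteq> b"
    by (rule AE_completion[OF AE_lborel_singleton])+
  then have "AE x in lebesgue. x \<in> {a..b} \<longrightarrow> u' x = y' x"
    by eventually_elim (use assms(3) in auto)
  from ac_deriv_cong_AE[OF assms(1) _ this] have "ac_deriv {a..b} y u'"
    by (simp add: is_interval_cc)
  then show ?thesis
    using assms(2) by (simp add: ac_deriv_def)
qed

lemma ac_deriv_glue:
  assumes "ac_deriv {a..b} y y'" "ac_deriv {b..c} y y'" "a \<le> b" "b \<le> c"
  shows "ac_deriv {a..c} y y'"
proof (rule ac_derivI)
  show ai: "y' absolutely_integrable_on {a..c}"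
    by (rule absolutely_integrable_on_combine) (use assms ac_deriv_abs_int in auto)
  fix t assume t: "a \<le> t" "t \<le> c"
  show "y t = y a + integral {a..t} y'"
  proof (cases "t \<le> b")
    case True then show ?thesis using ac_deriv_integral[OF assms(1), of a t] t assms by auto
  next
    case False
    have "y' absolutely_integrable_on {a..t}"
      using t by (intro absolutely_integrable_on_subinterval[OF ai]) auto
    then have "integral {a..b} y' + integral {b..t} y' = integral {a..t} y'"
      using False assms by (intro Henstock_Kurzweil_Integration.integral_combine set_lebesgue_integral_eq_integral) auto
    then show ?thesis
      using False ac_deriv_integral[OF assms(1), of a b] ac_deriv_integral[OF assms(2), of b t] t assms
      by (auto simp: algebra_simps)
  qed
qed

lemma absolutely_integrable_shift:
  fixes f :: "real \<Rightarrow> complex"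
  shows "f absolutely_integrable_on {a + c..b + c} \<longleftrightarrow> (\<lambda>x. f (x + c)) absolutely_integrable_on {a..b}"
  using integrable_shift_real_ivl_iff[of f c "a+c" "b+c"] integrable_shift_real_ivl_iff[of "\<lambda>x. norm (f x)" c "a+c" "b+c"]
  by (simp add: absolutely_integrable_on_def)

lemma ac_deriv_shift:
  "ac_deriv {a + c..b + c} y y' \<longleftrightarrow> ac_deriv {a..b} (\<lambda>x. y (x + c)) (\<lambda>x. y' (x + c))"
proof -
  have [simp]: "(\<forall>s\<in>{a+c..b+c}. P s) \<longleftrightarrow> (\<forall>s\<in>{a..b}. P (s + c))" for P
    by (metis (no_types, opaque_lifting) add_le_cancel_right atLeastAtMost_iff diff_add_cancel)
  have hi: "(y' has_integral i) {s + c..t + c} \<longleftrightarrow> ((\<lambda>x. y' (x + c)) has_integral i) {s..t}" for i s t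
    using has_integral_shift_real_ivl_iff[of y' i "s + c" "t + c" c] by simp
  show ?thesis
    unfolding ac_deriv_def by (simp add: absolutely_integrable_shift hi)
qed

lemma absolutely_integrable_continuous_mult:
  fixes f g :: "real \<Rightarrow> complex"
  assumes "continuous_on {a..b} f" "g absolutely_integrable_on {a..b}"
  shows "(\<lambda>x. f x * g x) absolutely_integrable_on {a..b}"
  by (rule absolutely_integrable_bounded_measurable_product[of "\<lambda>x y. x * y"])
    (auto intro!: assms bilinear_times continuous_imp_measurable_on_sets_lebesgue
      compact_imp_bounded compact_continuous_image)

text \<open>On an interval where u and v oscillate by at most e, the increment of u v differs from
  the integral of u' v + u v' by at most e times the integral of |u'| + |v'|. Both sides of this
  defect bound are additive over adjacent intervals, so bisection extends it to {a..t}; then e tends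
  to 0.\<close>

lemma ac_deriv_mult:
  assumes u: "ac_deriv {a..b} u u'" and v: "ac_deriv {a..b} v v'"
  shows "ac_deriv {a..b} (\<lambda>x. u x * v x) (\<lambda>x. u' x * v x + u x * v' x)"
proof (rule ac_derivI)
  let ?w = "\<lambda>x. u' x * v x + u x * v' x" and ?g = "\<lambda>x. cmod (u' x) + cmod (v' x)"
  note cu = ac_deriv_continuous[OF u] and cv = ac_deriv_continuous[OF v]
  note iu = ac_deriv_abs_int[OF u] and iv = ac_deriv_abs_int[OF v]
  have "(\<lambda>x. v x * u' x + u x * v' x) absolutely_integrable_on {a..b}"
    by (intro set_integral_add absolutely_integrable_continuous_mult cu cv iu iv)
  then show w: "?w absolutely_integrable_on {a..b}" by (simp add: mult.commute)
  have wi: "?w integrable_on {s..t}" "u' integrable_on {s..t}" "v' integrable_on {s..t}"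
    "(\<lambda>x. cmod (u' x)) integrable_on {s..t}" "(\<lambda>x. cmod (v' x)) integrable_on {s..t}"
    if "a \<le> s" "t \<le> b" for s t
  proof -
    have sub: "{s..t} \<subseteq> {a..b}" using that by auto
    note ai = absolutely_integrable_on_subinterval[OF _ sub]
    show "?w integrable_on {s..t}" "u' integrable_on {s..t}" "v' integrable_on {s..t}"
      "(\<lambda>x. cmod (u' x)) integrable_on {s..t}" "(\<lambda>x. cmod (v' x)) integrable_on {s..t}"
      using ai[OF w] ai[OF iu] ai[OF iv] unfolding absolutely_integrable_on_def by blast+
  qed
  fix t assume t: "a \<le> t" "t \<le> b"
  have bound: "cmod (u t * v t - u a * v a - integral {a..t} ?w) \<le> e * integral {a..t} ?g" if e: "e > 0" for e
  proof -
    define P where "P = (\<lambda>r s. a \<le> r \<longrightarrow> r \<le> s \<longrightarrow> s \<le> t \<longrightarrow>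
       cmod (u s * v s - u r * v r - integral {r..s} ?w) \<le> e * integral {r..s} ?g)"
    have "P a t"
    proof (rule Bolzano[OF t(1)])
      fix r s q assume *: "P r s" "P s q" "r \<le> s" "s \<le> q"
      show "P r q" unfolding P_def
      proof (intro impI)
        assume rq: "a \<le> r" "r \<le> q" "q \<le> t"
        have w1: "integral {r..s} ?w + integral {s..q} ?w = integral {r..q} ?w"
          using rq t * by (intro Henstock_Kurzweil_Integration.integral_combine wi) auto
        have g1: "integral {r..s} ?g + integral {s..q} ?g = integral {r..q} ?g"
          using rq t * by (intro Henstock_Kurzweil_Integration.integral_combine integrable_add wi) auto
        have eq: "u q * v q - u r * v r - integral {r..q} ?w =
            (u s * v s - u r * v r - integral {r..s} ?w) + (u q * v q - u s * v s - integral {s..q} ?w)"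
          unfolding w1[symmetric] by simp
        have Ps: "r \<le> s" "s \<le> t" "a \<le> s" "s \<le> q" using * rq by auto
        show "cmod (u q * v q - u r * v r - integral {r..q} ?w) \<le> e * integral {r..q} ?g"
          unfolding eq g1[symmetric] distrib_left
          using *(1,2)[unfolded P_def, rule_format] rq Ps by (intro norm_triangle_mono) blast+
      qed
    next
      fix x assume x: "a \<le> x" "x \<le> t"
      obtain d1 where d1: "d1 > 0" "\<And>r. r \<in> {a..b} \<Longrightarrow> dist r x < d1 \<Longrightarrow> dist (u r) (u x) < e/2"
        using cu[unfolded continuous_on_iff, rule_format, of x "e/2"] x t e by auto
      obtain d2 where d2: "d2 > 0" "\<And>r. r \<in> {a..b} \<Longrightarrow> dist r x < d2 \<Longrightarrow> dist (v r) (v x) < e/2"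
        using cv[unfolded continuous_on_iff, rule_format, of x "e/2"] x t e by auto
      have "P r s" if rs: "r \<le> x" "x \<le> s" "s - r < min d1 d2" for r s
        unfolding P_def
      proof (intro impI)
        assume **: "a \<le> r" "r \<le> s" "s \<le> t"
        have du: "cmod (u q - u q') \<le> e" if "q \<in> {r..s}" "q' \<in> {r..s}" for q q'
        proof -
          have "dist (u q) (u x) < e/2" "dist (u q') (u x) < e/2"
            by (rule d1(2); use that rs ** t in \<open>auto simp: dist_real_def\<close>)+
          then show ?thesis using dist_triangle_half_r[of "u x" "u q" e "u q'"] by (simp add: dist_norm norm_minus_commute)
        qed
        have dv: "cmod (v q - v q') \<le> e" if "q \<in> {r..s}" "q' \<in> {r..s}" for q q'
        proof -
          have "dist (v q) (v x) < e/2" "dist (v q') (v x) < e/2"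
            by (rule d2(2); use that rs ** t in \<open>auto simp: dist_real_def\<close>)+
          then show ?thesis using dist_triangle_half_r[of "v x" "v q" e "v q'"] by (simp add: dist_norm norm_minus_commute)
        qed
        have [simp]: "integral {r..s} u' = u s - u r" "integral {r..s} v' = v s - v r"
          using ac_deriv_integral[OF u, of r s] ac_deriv_integral[OF v, of r s] ** t by auto
        have i1: "(\<lambda>x. u' x * v s + u r * v' x) integrable_on {r..s}"
          using ** t by (auto intro!: wi integrable_add integrable_on_mult_left integrable_on_mult_right)
        have i2: "?w integrable_on {r..s}" using ** t by (intro wi) auto
        \<comment> \<open>Discrete product rule: v is frozen at the right end and u at the left end,
          so that the increment is exactly an integral and only the oscillations remain to be
          compared.\<close>
        have "u s * v s - u r * v r = integral {r..s} u' * v s + u r * integral {r..s} v'"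
          by (simp add: algebra_simps)
        also have "\<dots> = integral {r..s} (\<lambda>x. u' x * v s + u r * v' x)"
          using ** t by (subst Henstock_Kurzweil_Integration.integral_add) (auto intro!: wi integrable_on_mult_left integrable_on_mult_right)
        finally have "cmod (u s * v s - u r * v r - integral {r..s} ?w)
            = cmod (integral {r..s} (\<lambda>x. (u' x * v s + u r * v' x) - ?w x))"
          by (simp add: Henstock_Kurzweil_Integration.integral_diff[OF i1 i2])
        also have "\<dots> \<le> integral {r..s} (\<lambda>x. e * ?g x)"
        proof (rule Henstock_Kurzweil_Integration.integral_norm_bound_integral)
          fix q assume q: "q \<in> {r..s}"
          have "cmod (u' q * v s + u r * v' q - ?w q) = cmod (u' q * (v s - v q) + (u r - u q) * v' q)"
            by (simp add: algebra_simps)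
          also have "\<dots> \<le> cmod (u' q) * cmod (v s - v q) + cmod (u r - u q) * cmod (v' q)"
            by (metis norm_mult norm_triangle_ineq)
          also have "\<dots> \<le> cmod (u' q) * e + e * cmod (v' q)"
            using du[of r q] dv[of s q] q ** by (intro add_mono mult_left_mono mult_right_mono) auto
          finally show "cmod (u' q * v s + u r * v' q - ?w q) \<le> e * ?g q" by (simp add: algebra_simps)
        next
          show "(\<lambda>x. u' x * v s + u r * v' x - ?w x) integrable_on {r..s}"
            by (rule integrable_diff[OF i1 i2])
          show "(\<lambda>x. e * ?g x) integrable_on {r..s}"
            using ** t by (intro integrable_on_mult_right integrable_add wi) auto
        qed
        finally show "cmod (u s * v s - u r * v r - integral {r..s} ?w) \<le> e * integral {r..s} ?g" by simp
      qed
      then show "\<exists>d>0. \<forall>r s. r \<le> x \<and> x \<le> s \<and> s - r < d \<longrightarrow> P r s"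
        using d1 d2 by (intro exI[of _ "min d1 d2"]) auto
    qed
    then show ?thesis using t by (simp add: P_def)
  qed
  have "((\<lambda>e. e * integral {a..t} ?g) \<longlongrightarrow> 0 * integral {a..t} ?g) (at_right 0)"
    by (intro tendsto_intros)
  moreover have "\<forall>\<^sub>F e in at_right 0. cmod (u t * v t - u a * v a - integral {a..t} ?w) \<le> e * integral {a..t} ?g"
    using eventually_at_right_less by (rule eventually_mono) (rule bound)
  ultimately have "cmod (u t * v t - u a * v a - integral {a..t} ?w) \<le> 0 * integral {a..t} ?g"
    by (rule tendsto_lowerbound) (rule trivial_limit_at_right_real)
  then show "u t * v t = u a * v a + integral {a..t} ?w" by (simp add: algebra_simps)
qed

section \<open>The equation \<open>y'' = p y - f\<close> with integrable coefficients\<close>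

text \<open>The equation - y'' + p y = f as the first-order system y' = z, z' = p y - f in
  integrated form. The derivative z is an explicit argument because initial data, boundary
  conditions and the period map all use its point values.\<close>

definition ode_sol ::
    "real set \<Rightarrow> (real \<Rightarrow> complex) \<Rightarrow> (real \<Rightarrow> complex) \<Rightarrow> (real \<Rightarrow> complex) \<Rightarrow> (real \<Rightarrow> complex) \<Rightarrow> bool"
  where "ode_sol I p f y z \<longleftrightarrow> ac_deriv I y z \<and> ac_deriv I z (\<lambda>x. p x * y x - f x)"

lemma ode_sol_mono: "ode_sol I p f y z \<Longrightarrow> J \<subseteq> I \<Longrightarrow> ode_sol J p f y z"
  by (auto simp: ode_sol_def intro: ac_deriv_mono)

lemma ode_sol_lincomb:
  assumes "ode_sol I p f y z" "ode_sol I p g u v"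
  shows "ode_sol I p (\<lambda>x. c * f x + d * g x) (\<lambda>x. c * y x + d * u x) (\<lambda>x. c * z x + d * v x)"
proof -
  have eq: "(\<lambda>x. c * (p x * y x - f x) + d * (p x * u x - g x)) =
    (\<lambda>x. p x * (c * y x + d * u x) - (c * f x + d * g x))"
    by (simp add: algebra_simps)
  have "ac_deriv I (\<lambda>x. c * y x + d * u x) (\<lambda>x. c * z x + d * v x)"
    by (intro ac_deriv_add ac_deriv_cmult) (use assms in \<open>simp_all add: ode_sol_def\<close>)
  moreover have "ac_deriv I (\<lambda>x. c * z x + d * v x) (\<lambda>x. c * (p x * y x - f x) + d * (p x * u x - g x))"
    by (intro ac_deriv_add ac_deriv_cmult) (use assms in \<open>simp_all add: ode_sol_def\<close>)
  ultimately show ?thesis unfolding ode_sol_def eq by simp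
qed

lemma ode_sol_glue:
  "ode_sol {a..b} p f y z \<Longrightarrow> ode_sol {b..c} p f y z \<Longrightarrow> a \<le> b \<Longrightarrow> b \<le> c \<Longrightarrow> ode_sol {a..c} p f y z"
  by (auto simp: ode_sol_def intro: ac_deriv_glue)

lemma ode_sol_shift:
  "ode_sol {a + c..b + c} p f y z \<longleftrightarrow>
   ode_sol {a..b} (\<lambda>x. p (x + c)) (\<lambda>x. f (x + c)) (\<lambda>x. y (x + c)) (\<lambda>x. z (x + c))"
  by (simp add: ode_sol_def ac_deriv_shift)

lemma ode_sol_cong:
  assumes "ode_sol {a..b} p f y z"
    and "\<And>x. a \<le> x \<Longrightarrow> x \<le> b \<Longrightarrow> u x = y x" "\<And>x. a \<le> x \<Longrightarrow> x \<le> b \<Longrightarrow> v x = z x"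
    and "\<And>x. a < x \<Longrightarrow> x < b \<Longrightarrow> q x = p x" "\<And>x. a < x \<Longrightarrow> x < b \<Longrightarrow> g x = f x"
  shows "ode_sol {a..b} q g u v"
proof -
  have 1: "ac_deriv {a..b} y z" and 2: "ac_deriv {a..b} z (\<lambda>x. p x * y x - f x)"
    using assms(1) by (simp_all add: ode_sol_def)
  show ?thesis
    unfolding ode_sol_def using ac_deriv_cong[OF 1, of u v] ac_deriv_cong[OF 2, of v "\<lambda>x. q x * u x - g x"] assms(2-)
    by simp
qed

text \<open>Let m be the maximum of |z|. Integrating z bounds |y| by |y a| + (b - a) m, and
  inserting this into the integral for z bounds m by data plus (b - a) P m, where P is the integral
  of |p|. The shortness condition makes the last term at most m / 2, so it is absorbed; its summand
  1 also gives b - a <= 1/2, used when the bound returns to y.\<close>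

lemma ode_sol_estimate_short:
  assumes sol: "ode_sol {a..b} p f y z" and ab: "a \<le> b"
    and p: "p absolutely_integrable_on {a..b}" and f: "f absolutely_integrable_on {a..b}"
    and short: "(b - a) * (1 + integral {a..b} (\<lambda>x. cmod (p x))) \<le> 1 / 2"
    and s: "s \<in> {a..b}"
  shows "cmod (y s) + cmod (z s) \<le> (5 + 4 * integral {a..b} (\<lambda>x. cmod (p x))) *
           (cmod (y a) + cmod (z a) + integral {a..b} (\<lambda>x. cmod (f x)))"
proof -
  let ?P = "integral {a..b} (\<lambda>x. cmod (p x))" and ?F = "integral {a..b} (\<lambda>x. cmod (f x))"
  have y: "ac_deriv {a..b} y z" and z: "ac_deriv {a..b} z (\<lambda>x. p x * y x - f x)"
    using sol by (auto simp: ode_sol_def)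
  have pf: "(\<lambda>x. cmod (p x)) integrable_on {a..b}" "(\<lambda>x. cmod (f x)) integrable_on {a..b}"
    using p f by (auto simp: absolutely_integrable_on_def)
  have P0: "?P \<ge> 0" and F0: "?F \<ge> 0"
    by (intro Henstock_Kurzweil_Integration.integral_nonneg pf; simp)+
  have h: "b - a \<le> 1/2" "(b - a) * ?P \<le> 1/2"
    using short P0 ab mult_nonneg_nonneg[of "b - a" ?P] by (auto simp: algebra_simps)
  obtain x0 where x0: "x0 \<in> {a..b}" "\<And>x. x \<in> {a..b} \<Longrightarrow> cmod (z x) \<le> cmod (z x0)"
    using continuous_attains_sup[of "{a..b}" "\<lambda>x. cmod (z x)"] continuous_on_norm[OF ac_deriv_continuous[OF z]] ab
    by fastforce
  let ?m = "cmod (z x0)"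
  have yb: "cmod (y x) \<le> cmod (y a) + (b - a) * ?m" if x: "x \<in> {a..b}" for x
  proof -
    have "cmod (integral {a..x} z) \<le> integral {a..x} (\<lambda>_. ?m)"
      using x x0(2) ac_deriv_abs_int[OF ac_deriv_mono[OF y, of "{a..x}"]]
      by (intro Henstock_Kurzweil_Integration.integral_norm_bound_integral set_lebesgue_integral_eq_integral(1)) auto
    also have "\<dots> \<le> (b - a) * ?m" using x by (simp add: mult_right_mono)
    finally have "cmod (y x - y a) \<le> (b - a) * ?m"
      using ac_deriv_integral[OF y, of a x] x ab by simp
    then show ?thesis using norm_triangle_ineq2[of "y x" "y a"] by linarith
  qed
  have "?m \<le> cmod (z a) + (?P * (cmod (y a) + (b - a) * ?m) + ?F)"
  proof -
    have sub: "{a..x0} \<subseteq> {a..b}" using x0 by auto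
    have pf0: "(\<lambda>x. cmod (p x)) integrable_on {a..x0}" "(\<lambda>x. cmod (f x)) integrable_on {a..x0}"
      using integrable_on_subinterval[OF pf(1) sub] integrable_on_subinterval[OF pf(2) sub] by auto
    have "cmod (integral {a..x0} (\<lambda>x. p x * y x - f x)) \<le>
       integral {a..x0} (\<lambda>x. cmod (p x) * (cmod (y a) + (b - a) * ?m) + cmod (f x))"
    proof (rule Henstock_Kurzweil_Integration.integral_norm_bound_integral)
      show "(\<lambda>x. p x * y x - f x) integrable_on {a..x0}"
        using ac_deriv_abs_int[OF ac_deriv_mono[OF z sub]] by (rule set_lebesgue_integral_eq_integral)
      show "(\<lambda>x. cmod (p x) * (cmod (y a) + (b - a) * ?m) + cmod (f x)) integrable_on {a..x0}"
        by (intro integrable_add integrable_on_mult_left pf0)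
      fix x assume "x \<in> {a..x0}"
      then have "cmod (p x * y x) \<le> cmod (p x) * (cmod (y a) + (b - a) * ?m)"
        using sub by (auto simp: norm_mult intro!: mult_left_mono yb)
      then show "cmod (p x * y x - f x) \<le> cmod (p x) * (cmod (y a) + (b - a) * ?m) + cmod (f x)"
        using norm_triangle_ineq4[of "p x * y x" "f x"] by linarith
    qed
    also have "\<dots> = integral {a..x0} (\<lambda>x. cmod (p x)) * (cmod (y a) + (b - a) * ?m) + integral {a..x0} (\<lambda>x. cmod (f x))"
      by (subst Henstock_Kurzweil_Integration.integral_add) (auto intro!: integrable_on_mult_left pf0)
    also have "\<dots> \<le> ?P * (cmod (y a) + (b - a) * ?m) + ?F"
      using ab by (intro add_mono mult_right_mono integral_subset_le sub pf pf0) auto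
    finally have "cmod (z x0 - z a) \<le> ?P * (cmod (y a) + (b - a) * ?m) + ?F"
      using ac_deriv_integral[OF z, of a x0] x0 ab by simp
    then show ?thesis using norm_triangle_ineq2[of "z x0" "z a"] by linarith
  qed
  moreover have "?P * (cmod (y a) + (b - a) * ?m) \<le> ?P * cmod (y a) + ?m / 2"
    using mult_right_mono[OF h(2), of ?m] by (simp add: algebra_simps)
  moreover have "r \<le> 2 * (za + u + F)" if "r \<le> za + (v + F)" "v \<le> u + r / 2" for r za u v F :: real
    using that by (simp add: field_simps)
  ultimately have m: "?m \<le> 2 * (cmod (z a) + ?P * cmod (y a) + ?F)" by blast
  have "(b - a) * ?m \<le> ?m / 2"
    using mult_right_mono[OF h(1), of ?m] by simp
  then have "cmod (y s) + cmod (z s) \<le> cmod (y a) + 2 * ?m"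
    using yb[OF s] x0(2)[OF s] norm_ge_zero[of "z x0"] by linarith
  also have "\<dots> \<le> cmod (y a) + 4 * (cmod (z a) + ?P * cmod (y a) + ?F)"
    using m by linarith
  also have "\<dots> \<le> (5 + 4 * ?P) * (cmod (y a) + cmod (z a) + ?F)"
    using P0 F0 by (simp add: distrib_left distrib_right add_increasing)
  finally show ?thesis .
qed

text \<open>The unknown of the fixed point problem is the derivative w: \<open>K w\<close> recovers
  y from it and \<open>G w\<close> is the integrated equation. In the sup norm the map has Lipschitz
  constant (b - a) times the integral of |p|, hence at most 1/2.\<close>

lemma ode_sol_exists_short:
  assumes ab: "a \<le> b"
    and p: "p absolutely_integrable_on {a..b}" and f: "f absolutely_integrable_on {a..b}"
    and short: "(b - a) * (1 + integral {a..b} (\<lambda>x. cmod (p x))) \<le> 1 / 2"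
  shows "\<exists>y z. ode_sol {a..b} p f y z \<and> y a = y0 \<and> z a = z0"
proof -
  let ?P = "integral {a..b} (\<lambda>x. cmod (p x))"
  define K where "K w s = y0 + integral {a..s} w" for w :: "real \<Rightarrow> complex" and s
  define G where "G w t = z0 + integral {a..t} (\<lambda>s. p s * K w s - f s)" for w t
  \<comment> \<open>Retraction of the line onto {a..b}. The complete space at hand consists of
    bounded continuous functions on all of the line, so \<open>G w\<close> is extended by constants
    beyond the end points.\<close>
  define cl where "cl t = max a (min b t)" for t
  have cl: "cl t \<in> {a..b}" "t \<in> {a..b} \<Longrightarrow> cl t = t" for t using ab by (auto simp: cl_def)
  have pint: "(\<lambda>x. cmod (p x)) integrable_on {a..b}" using p by (auto simp: absolutely_integrable_on_def)
  have P0: "?P \<ge> 0" by (intro Henstock_Kurzweil_Integration.integral_nonneg pint) simp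
  have h: "(b - a) * ?P \<le> 1/2"
    using short P0 ab by (auto simp: algebra_simps)
  have K: "continuous_on {a..b} (K w)" if "continuous_on {a..b} w" for w
    unfolding K_def by (intro continuous_intros indefinite_integral_continuous_1 integrable_continuous_real that)
  have I: "(\<lambda>s. p s * K w s - f s) absolutely_integrable_on {a..b}" if "continuous_on {a..b} w" for w
    using set_integral_diff(1)[OF absolutely_integrable_continuous_mult[OF K[OF that] p] f] by (simp add: mult.commute)
  have G: "continuous_on {a..b} (G w)" if "continuous_on {a..b} w" for w
    unfolding G_def by (intro continuous_intros indefinite_integral_continuous_1 set_lebesgue_integral_eq_integral I that)
  have Gcl: "(\<lambda>t. G w (cl t)) \<in> bcontfun" if w: "continuous_on {a..b} w" for w
  proof -
    have "continuous_on UNIV (\<lambda>t. G w (cl t))"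
      by (rule continuous_on_compose2[OF G[OF w]]) (use cl in \<open>auto simp: cl_def intro!: continuous_intros\<close>)
    moreover have "bounded (G w ` {a..b})"
      by (intro compact_imp_bounded compact_continuous_image G w) auto
    then have "bounded (range (\<lambda>t. G w (cl t)))"
      by (rule bounded_subset) (use cl in auto)
    ultimately show ?thesis by (simp add: bcontfun_def)
  qed
  define \<Phi> where "\<Phi> w = Bcontfun (\<lambda>t. G (apply_bcontfun w) (cl t))" for w
  have \<Phi>: "apply_bcontfun (\<Phi> w) t = G (apply_bcontfun w) (cl t)" for w t
    unfolding \<Phi>_def by (subst Bcontfun_inverse) (auto intro!: Gcl)
  have "\<exists>!w. \<Phi> w = w"
  proof (rule banach_fix_type[of "1/2"])
    show "\<forall>w v. dist (\<Phi> w) (\<Phi> v) \<le> 1 / 2 * dist w v"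
    proof (intro allI dist_bound)
      fix w v :: "real \<Rightarrow>\<^sub>C complex" and t
      let ?t = "cl t" and ?D = "dist w v"
      let ?w = "apply_bcontfun w" and ?v = "apply_bcontfun v"
      have sub: "{a..?t} \<subseteq> {a..b}" using cl(1)[of t] by auto
      have Iw: "(\<lambda>s. p s * K ?w s - f s) integrable_on {a..?t}" "(\<lambda>s. p s * K ?v s - f s) integrable_on {a..?t}"
        by (intro set_lebesgue_integral_eq_integral absolutely_integrable_on_subinterval[OF I sub] continuous_on_apply_bcontfun)+
      have pt: "(\<lambda>x. cmod (p x)) integrable_on {a..?t}" by (rule integrable_on_subinterval[OF pint sub])
      have KK: "cmod (K ?w s - K ?v s) \<le> (b - a) * ?D" if s: "s \<in> {a..b}" for s
      proof -
        have ii: "?w integrable_on {a..s}" "?v integrable_on {a..s}"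
          by (auto intro!: integrable_continuous_real)
        have "cmod (K ?w s - K ?v s) = cmod (integral {a..s} (\<lambda>x. ?w x - ?v x))"
          by (simp add: K_def Henstock_Kurzweil_Integration.integral_diff ii)
        also have "\<dots> \<le> integral {a..s} (\<lambda>x. ?D)"
          by (intro Henstock_Kurzweil_Integration.integral_norm_bound_integral integrable_diff ii)
             (auto simp: dist_norm[symmetric] dist_bounded)
        also have "\<dots> \<le> (b - a) * ?D" using s by (simp add: mult_right_mono)
        finally show ?thesis .
      qed
      have "dist (apply_bcontfun (\<Phi> w) t) (apply_bcontfun (\<Phi> v) t) =
          cmod (integral {a..?t} (\<lambda>s. (p s * K ?w s - f s) - (p s * K ?v s - f s)))"
        unfolding Henstock_Kurzweil_Integration.integral_diff[OF Iw] by (simp add: \<Phi> G_def dist_norm)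
      also have "\<dots> \<le> integral {a..?t} (\<lambda>s. cmod (p s) * ((b - a) * ?D))"
      proof (intro Henstock_Kurzweil_Integration.integral_norm_bound_integral integrable_diff[OF Iw] integrable_on_mult_left pt)
        fix s assume "s \<in> {a..?t}"
        then have "cmod (p s) * cmod (K ?w s - K ?v s) \<le> cmod (p s) * ((b - a) * ?D)"
          using sub by (intro mult_left_mono KK) auto
        then show "cmod (p s * K ?w s - f s - (p s * K ?v s - f s)) \<le> cmod (p s) * ((b - a) * ?D)"
          by (simp add: norm_mult[symmetric] algebra_simps)
      qed
      also have "\<dots> = integral {a..?t} (\<lambda>s. cmod (p s)) * ((b - a) * ?D)"
        by (rule Henstock_Kurzweil_Integration.integral_mult_left)
      also have "\<dots> \<le> ?P * ((b - a) * ?D)"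
        using ab by (intro mult_right_mono integral_subset_le sub pint pt) auto
      also have "\<dots> \<le> 1 / 2 * ?D" using mult_right_mono[OF h, of ?D] by (simp add: algebra_simps)
      finally show "dist (apply_bcontfun (\<Phi> w) t) (apply_bcontfun (\<Phi> v) t) \<le> 1 / 2 * ?D" .
    qed
  qed auto
  then obtain w where w: "\<Phi> w = w" by auto
  let ?w = "apply_bcontfun w"
  have wG: "?w t = G ?w t" if "t \<in> {a..b}" for t
    using \<Phi>[of w t] w cl(2)[OF that] by simp
  have "ac_deriv {a..b} (K ?w) ?w"
    by (rule ac_derivI) (auto simp: K_def intro!: absolutely_integrable_continuous_real)
  moreover have "ac_deriv {a..b} ?w (\<lambda>x. p x * K ?w x - f x)"
    by (rule ac_derivI) (use wG ab in \<open>auto simp: G_def intro!: I\<close>)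
  ultimately have "ode_sol {a..b} p f (K ?w) ?w" by (simp add: ode_sol_def)
  moreover have "K ?w a = y0" "?w a = z0" using wG[of a] ab by (auto simp: K_def G_def)
  ultimately show ?thesis by blast
qed

text \<open>The integral of |p| over a subinterval is at most P, its value over {a..b}, so one
  length 1 / (2 (1 + P)) makes every subinterval short enough. Bisection then reduces to pasting:
  the data for the right piece are the end values of the left one.\<close>

lemma ode_sol_exists:
  assumes ab: "a \<le> b"
    and p: "p absolutely_integrable_on {a..b}" and f: "f absolutely_integrable_on {a..b}"
  shows "\<exists>y z. ode_sol {a..b} p f y z \<and> y a = y0 \<and> z a = z0"
proof -
  let ?P = "integral {a..b} (\<lambda>x. cmod (p x))"
  have pint: "(\<lambda>x. cmod (p x)) integrable_on {a..b}" using p by (auto simp: absolutely_integrable_on_def)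
  have P0: "?P \<ge> 0" by (intro Henstock_Kurzweil_Integration.integral_nonneg pint) simp
  define Q where "Q c d \<longleftrightarrow> a \<le> c \<longrightarrow> c \<le> d \<longrightarrow> d \<le> b \<longrightarrow>
    (\<forall>y0 z0. \<exists>y z. ode_sol {c..d} p f y z \<and> y c = y0 \<and> z c = z0)" for c d
  have "Q a b"
    using ab
  proof (induction rule: Bolzano)
    case (trans c d e)
    show ?case unfolding Q_def
    proof (intro impI allI)
      fix y0 z0 assume *: "a \<le> c" "c \<le> e" "e \<le> b"
      have ex: "\<forall>y0 z0. \<exists>y z. ode_sol {c..d} p f y z \<and> y c = y0 \<and> z c = z0"
        "\<forall>y0 z0. \<exists>y z. ode_sol {d..e} p f y z \<and> y d = y0 \<and> z d = z0"
        using trans * by (simp_all add: Q_def)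
      obtain y z where yz: "ode_sol {c..d} p f y z" "y c = y0" "z c = z0"
        using ex(1) by blast
      obtain u v where uv: "ode_sol {d..e} p f u v" "u d = y d" "v d = z d"
        using ex(2) by blast
      define Y where "Y x = (if x \<le> d then y x else u x)" for x
      define Z where "Z x = (if x \<le> d then z x else v x)" for x
      have "ode_sol {c..d} p f Y Z"
        by (rule ode_sol_cong[OF yz(1)]) (auto simp: Y_def Z_def)
      moreover have "ode_sol {d..e} p f Y Z"
        by (rule ode_sol_cong[OF uv(1)]) (use uv in \<open>auto simp: Y_def Z_def\<close>)
      ultimately have "ode_sol {c..e} p f Y Z"
        by (rule ode_sol_glue) (use trans in simp_all)
      moreover have "Y c = y0" "Z c = z0" using yz trans by (auto simp: Y_def Z_def)
      ultimately show "\<exists>y z. ode_sol {c..e} p f y z \<and> y c = y0 \<and> z c = z0" by blast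
    qed
  next
    case (local x)
    have "Q c d" if "d - c < 1 / (2 * (1 + ?P))" for c d
      unfolding Q_def
    proof (intro impI allI)
      fix y0 z0 assume *: "a \<le> c" "c \<le> d" "d \<le> b"
      then have sub: "{c..d} \<subseteq> {a..b}" by auto
      have "integral {c..d} (\<lambda>x. cmod (p x)) \<le> ?P"
        by (intro integral_subset_le sub pint integrable_on_subinterval[OF pint sub]) auto
      then have "(d - c) * (1 + integral {c..d} (\<lambda>x. cmod (p x))) \<le> (d - c) * (1 + ?P)"
        using * by (intro mult_left_mono) auto
      also have "\<dots> \<le> 1 / (2 * (1 + ?P)) * (1 + ?P)"
        using that P0 by (intro mult_right_mono) auto
      also have "\<dots> = 1 / 2" using P0 by simp
      finally show "\<exists>y z. ode_sol {c..d} p f y z \<and> y c = y0 \<and> z c = z0"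
        using * by (intro ode_sol_exists_short absolutely_integrable_on_subinterval[OF p sub]
            absolutely_integrable_on_subinterval[OF f sub])
    qed
    then show ?case using P0 by (intro exI[of _ "1 / (2 * (1 + ?P))"]) auto
  qed
  then show ?thesis using ab unfolding Q_def by blast
qed

text \<open>The constant is chosen before f, y and z and depends only on p and the interval. With
  zero right-hand side and zero data this is uniqueness; with periodic p it gives one bound valid on
  all integer translates of the unit interval.\<close>

lemma ode_sol_estimate:
  assumes ab: "a \<le> b" and p: "p absolutely_integrable_on {a..b}"
  shows "\<exists>C\<ge>0. \<forall>f y z s. f absolutely_integrable_on {a..b} \<longrightarrow> ode_sol {a..b} p f y z \<longrightarrow> s \<in> {a..b} \<longrightarrow>
       cmod (y s) + cmod (z s) \<le> C * (cmod (y a) + cmod (z a) + integral {a..b} (\<lambda>x. cmod (f x)))"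
proof -
  let ?P = "integral {a..b} (\<lambda>x. cmod (p x))"
  have pint: "(\<lambda>x. cmod (p x)) integrable_on {a..b}" using p by (auto simp: absolutely_integrable_on_def)
  have P0: "?P \<ge> 0" by (intro Henstock_Kurzweil_Integration.integral_nonneg pint) simp
  define R where "R c d C \<longleftrightarrow> (\<forall>f y z s. f absolutely_integrable_on {c..d} \<longrightarrow> ode_sol {c..d} p f y z \<longrightarrow>
      s \<in> {c..d} \<longrightarrow> cmod (y s) + cmod (z s) \<le>
        C * (cmod (y c) + cmod (z c) + integral {c..d} (\<lambda>x. cmod (f x))))" for c d C
  define Q where "Q c d \<longleftrightarrow> a \<le> c \<longrightarrow> c \<le> d \<longrightarrow> d \<le> b \<longrightarrow> (\<exists>C\<ge>0. R c d C)" for c d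
  have "Q a b"
    using ab
  proof (induction rule: Bolzano)
    case (trans c d e)
    show ?case unfolding Q_def
    proof (intro impI)
      assume *: "a \<le> c" "c \<le> e" "e \<le> b"
      have ex: "\<exists>C\<ge>0. R c d C" "\<exists>C\<ge>0. R d e C"
        using trans * by (simp_all add: Q_def)
      obtain C1 where C1: "C1 \<ge> 0" "R c d C1"
        using ex(1) by blast
      obtain C2 where C2: "C2 \<ge> 0" "R d e C2"
        using ex(2) by blast
      \<comment> \<open>The data at the junction d are at most C1 (A + F), and the forcing on the
        right piece at most A + F; this gives C2 (C1 + 1) there. Adding C1 covers both pieces at
        once.\<close>
      have "R c e (C1 + C2 * (C1 + 1))" unfolding R_def
      proof (intro allI impI)
        fix f y z s assume f: "f absolutely_integrable_on {c..e}" and sol: "ode_sol {c..e} p f y z" and s: "s \<in> {c..e}"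
        have sub: "{c..d} \<subseteq> {c..e}" "{d..e} \<subseteq> {c..e}" using trans by auto
        have fint: "(\<lambda>x. cmod (f x)) integrable_on {c..e}" using f by (auto simp: absolutely_integrable_on_def)
        define A where "A = cmod (y c) + cmod (z c)"
        define F where "F = integral {c..e} (\<lambda>x. cmod (f x))"
        define F1 where "F1 = integral {c..d} (\<lambda>x. cmod (f x))"
        define F2 where "F2 = integral {d..e} (\<lambda>x. cmod (f x))"
        have F: "F1 \<le> F" "F2 \<le> F" "F \<ge> 0"
          unfolding F_def F1_def F2_def
          by (intro integral_subset_le sub fint integrable_on_subinterval[OF fint sub(1)]
              integrable_on_subinterval[OF fint sub(2)] Henstock_Kurzweil_Integration.integral_nonneg; simp)+
        have A: "A \<ge> 0" by (simp add: A_def)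
        have 1: "cmod (y s) + cmod (z s) \<le> C1 * (A + F)" if "s \<in> {c..d}" for s
        proof -
          have "cmod (y s) + cmod (z s) \<le> C1 * (A + F1)"
            using C1(2) that ode_sol_mono[OF sol sub(1)] absolutely_integrable_on_subinterval[OF f sub(1)]
            unfolding R_def A_def F1_def by blast
          also have "\<dots> \<le> C1 * (A + F)" using F C1 by (intro mult_left_mono) auto
          finally show ?thesis .
        qed
        have 2: "cmod (y s) + cmod (z s) \<le> C2 * (C1 + 1) * (A + F)" if "s \<in> {d..e}" for s
        proof -
          have "cmod (y s) + cmod (z s) \<le> C2 * (cmod (y d) + cmod (z d) + F2)"
            using C2(2) that ode_sol_mono[OF sol sub(2)] absolutely_integrable_on_subinterval[OF f sub(2)]
            unfolding R_def F2_def by blast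
          also have "\<dots> \<le> C2 * (C1 * (A + F) + (A + F))"
            using F A C2 1[of d] trans by (intro mult_left_mono add_mono) auto
          finally show ?thesis by (simp add: algebra_simps)
        qed
        have nn: "0 \<le> C1 * (A + F)" "0 \<le> C2 * (C1 + 1) * (A + F)" using A F C1 C2 by auto
        have "cmod (y s) + cmod (z s) \<le> C1 * (A + F) + C2 * (C1 + 1) * (A + F)"
          using 1[of s] 2[of s] s nn by (cases "s \<le> d") auto
        then show "cmod (y s) + cmod (z s) \<le> (C1 + C2 * (C1 + 1)) * (cmod (y c) + cmod (z c) + integral {c..e} (\<lambda>x. cmod (f x)))"
          unfolding A_def F_def by (simp add: distrib_right)
      qed
      then show "\<exists>C\<ge>0. R c e C" using C1 C2 by (intro exI[of _ "C1 + C2 * (C1 + 1)"]) auto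
    qed
  next
    case (local x)
    have "Q c d" if "d - c < 1 / (2 * (1 + ?P))" for c d
      unfolding Q_def
    proof (intro impI)
      assume *: "a \<le> c" "c \<le> d" "d \<le> b"
      then have sub: "{c..d} \<subseteq> {a..b}" by auto
      have pc: "(\<lambda>x. cmod (p x)) integrable_on {c..d}" by (rule integrable_on_subinterval[OF pint sub])
      have "integral {c..d} (\<lambda>x. cmod (p x)) \<le> ?P"
        by (intro integral_subset_le sub pint pc) auto
      then have "(d - c) * (1 + integral {c..d} (\<lambda>x. cmod (p x))) \<le> (d - c) * (1 + ?P)"
        using * by (intro mult_left_mono) auto
      also have "\<dots> \<le> 1 / (2 * (1 + ?P)) * (1 + ?P)"
        using that P0 by (intro mult_right_mono) auto
      also have "\<dots> = 1 / 2" using P0 by simp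
      finally have short: "(d - c) * (1 + integral {c..d} (\<lambda>x. cmod (p x))) \<le> 1 / 2" .
      have "R c d (5 + 4 * integral {c..d} (\<lambda>x. cmod (p x)))"
        unfolding R_def using ode_sol_estimate_short[OF _ *(2) absolutely_integrable_on_subinterval[OF p sub] _ short]
        by blast
      moreover have "0 \<le> integral {c..d} (\<lambda>x. cmod (p x))"
        by (intro Henstock_Kurzweil_Integration.integral_nonneg pc) simp
      ultimately show "\<exists>C\<ge>0. R c d C" by (intro exI[of _ "5 + 4 * integral {c..d} (\<lambda>x. cmod (p x))"]) simp
    qed
    then show ?case using P0 by (intro exI[of _ "1 / (2 * (1 + ?P))"]) auto
  qed
  then show ?thesis using ab unfolding Q_def R_def by simp
qed

lemma ode_sol_unique:
  assumes ab: "a \<le> b" and p: "p absolutely_integrable_on {a..b}"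
    and sol: "ode_sol {a..b} p f y z" "ode_sol {a..b} p f u v" and init: "y a = u a" "z a = v a"
    and s: "s \<in> {a..b}"
  shows "y s = u s" "z s = v s"
proof -
  obtain C where C: "\<forall>f y z s. f absolutely_integrable_on {a..b} \<longrightarrow> ode_sol {a..b} p f y z \<longrightarrow> s \<in> {a..b} \<longrightarrow>
       cmod (y s) + cmod (z s) \<le> C * (cmod (y a) + cmod (z a) + integral {a..b} (\<lambda>x. cmod (f x)))"
    using ode_sol_estimate[OF ab p] by (elim exE conjE)
  have "ode_sol {a..b} p (\<lambda>x. 1 * f x + (-1) * f x) (\<lambda>x. 1 * y x + (-1) * u x) (\<lambda>x. 1 * z x + (-1) * v x)"
    by (rule ode_sol_lincomb[OF sol])
  then have "ode_sol {a..b} p (\<lambda>x. 0) (\<lambda>x. y x - u x) (\<lambda>x. z x - v x)" by simp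
  from C[rule_format, OF _ this s] have "cmod (y s - u s) + cmod (z s - v s) \<le> 0"
    using init by simp
  moreover have "cmod (y s - u s) \<ge> 0" "cmod (z s - v s) \<ge> 0" by simp_all
  ultimately have "cmod (y s - u s) = 0" "cmod (z s - v s) = 0" by linarith+
  then show "y s = u s" "z s = v s" by simp_all
qed

text \<open>The terms p y u cancel in the derivative of y v - z u. For the two basic solutions this
  says that the period map has determinant 1.\<close>

lemma wronskian_const:
  assumes "ode_sol {a..b} p (\<lambda>x. 0) y z" "ode_sol {a..b} p (\<lambda>x. 0) u v" "a \<le> b"
  shows "y b * v b - z b * u b = y a * v a - z a * u a"
proof -
  have 1: "ac_deriv {a..b} y z" "ac_deriv {a..b} z (\<lambda>x. p x * y x)"
    "ac_deriv {a..b} u v" "ac_deriv {a..b} v (\<lambda>x. p x * u x)"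
    using assms by (simp_all add: ode_sol_def)
  have "ac_deriv {a..b} (\<lambda>x. y x * v x + (-1) * (z x * u x))
     (\<lambda>x. (z x * v x + y x * (p x * u x)) + (-1) * (p x * y x * u x + z x * v x))"
    by (intro ac_deriv_add ac_deriv_cmult ac_deriv_mult 1)
  then have "ac_deriv {a..b} (\<lambda>x. y x * v x - z x * u x) (\<lambda>x. 0)"
    by (simp add: algebra_simps)
  from ac_deriv_integral[OF this, of a b] show ?thesis using assms(3) by simp
qed

text \<open>The derivative of z cnj y is p |y|^2 - f cnj y + |z|^2 almost everywhere. Taking
  imaginary parts removes |z|^2, so no bound on y' is needed inside the interval; the sign \<sigma>
  makes the remaining quadratic term positive.\<close>

lemma energy_estimate:
  assumes sol: "ode_sol {a..b} p f y z" and ab: "a \<le> b"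
    and f: "f absolutely_integrable_on {a..b}"
    and \<sigma>: "\<bar>\<sigma>\<bar> = 1" and pos: "AE x in lebesgue. \<delta> \<le> \<sigma> * Im (p x)"
  shows "\<delta> * integral {a..b} (\<lambda>x. (cmod (y x))\<^sup>2) \<le>
    \<bar>Im (z b * cnj (y b)) - Im (z a * cnj (y a))\<bar> + integral {a..b} (\<lambda>x. cmod (f x) * cmod (y x))"
proof -
  have y: "ac_deriv {a..b} y z" and z: "ac_deriv {a..b} z (\<lambda>x. p x * y x - f x)"
    using sol by (simp_all add: ode_sol_def)
  define g where "g x = (p x * y x - f x) * cnj (y x) + z x * cnj (z x)" for x
  have zy: "ac_deriv {a..b} (\<lambda>x. z x * cnj (y x)) g"
    unfolding g_def by (rule ac_deriv_mult[OF z ac_deriv_cnj[OF y]])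
  have cy: "continuous_on {a..b} y" by (rule ac_deriv_continuous[OF y])
  have gi: "g integrable_on {a..b}"
    using ac_deriv_abs_int[OF zy] by (rule set_lebesgue_integral_eq_integral)
  have Img: "((\<lambda>x. Im (g x)) has_integral Im (integral {a..b} g)) {a..b}"
    using has_integral_linear[OF integrable_integral[OF gi] bounded_linear_Im] by (simp add: o_def)
  have fy: "(\<lambda>x. cmod (f x) * cmod (y x)) integrable_on {a..b}"
    using absolutely_integrable_continuous_mult[OF cy f]
    by (simp add: absolutely_integrable_on_def norm_mult mult.commute)
  have yy: "(\<lambda>x. (cmod (y x))\<^sup>2) integrable_on {a..b}"
    by (intro integrable_continuous_real continuous_intros cy)
  obtain N where N: "\<And>x. x \<in> space lebesgue - N \<Longrightarrow> \<delta> \<le> \<sigma> * Im (p x)" "N \<in> null_sets lebesgue"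
    using AE_E3[OF pos] by blast
  have neg: "negligible N" using N(2) by (simp add: negligible_iff_null_sets)
  \<comment> \<open>The lower bound on Im p fails on a null set, while the comparison of integrals
    is pointwise; hence both integrands are reset to 0 there.\<close>
  define k where "k x = (if x \<in> N then 0 else \<delta> * (cmod (y x))\<^sup>2)" for x
  define m where "m x = (if x \<in> N then 0 else \<sigma> * Im (g x) + cmod (f x) * cmod (y x))" for x
  have k: "(k has_integral \<delta> * integral {a..b} (\<lambda>x. (cmod (y x))\<^sup>2)) {a..b}"
    by (rule has_integral_spike[OF neg _ has_integral_mult_right[OF integrable_integral[OF yy]]]) (simp add: k_def)
  have m: "(m has_integral (\<sigma> * Im (integral {a..b} g) + integral {a..b} (\<lambda>x. cmod (f x) * cmod (y x)))) {a..b}"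
    by (rule has_integral_spike[OF neg _ has_integral_add[OF has_integral_mult_right[OF Img] integrable_integral[OF fy]]])
      (simp add: m_def)
  have "\<delta> * integral {a..b} (\<lambda>x. (cmod (y x))\<^sup>2) \<le>
    \<sigma> * Im (integral {a..b} g) + integral {a..b} (\<lambda>x. cmod (f x) * cmod (y x))"
  proof (rule has_integral_le[OF k m])
    fix x assume "x \<in> {a..b}"
    show "k x \<le> m x"
    proof (cases "x \<in> N")
      case False
      have "Im (g x) = Im (p x) * (cmod (y x))\<^sup>2 - Im (f x * cnj (y x))"
        unfolding cmod_power2 g_def by (simp add: algebra_simps power2_eq_square)
      then have "\<sigma> * Im (g x) = (\<sigma> * Im (p x)) * (cmod (y x))\<^sup>2 - \<sigma> * Im (f x * cnj (y x))"
        by (simp only: right_diff_distrib mult.assoc)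
      moreover have "\<delta> * (cmod (y x))\<^sup>2 \<le> (\<sigma> * Im (p x)) * (cmod (y x))\<^sup>2"
        using N(1)[of x] False by (intro mult_right_mono) auto
      moreover have "\<bar>\<sigma> * Im (f x * cnj (y x))\<bar> \<le> cmod (f x) * cmod (y x)"
        using abs_Im_le_cmod[of "f x * cnj (y x)"] \<sigma> by (simp add: abs_mult norm_mult)
      ultimately show ?thesis using False by (simp add: k_def m_def)
    qed (simp add: k_def m_def)
  qed
  also have "\<sigma> * Im (integral {a..b} g) \<le> \<bar>Im (integral {a..b} g)\<bar>"
    using \<sigma> abs_ge_self[of "\<sigma> * Im (integral {a..b} g)"] by (simp add: abs_mult)
  also have "integral {a..b} g = z b * cnj (y b) - z a * cnj (y a)"
    using ac_deriv_integral[OF zy, of a b] ab by simp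
  finally show ?thesis by simp
qed

section \<open>Square-integrable functions and bounded inverses\<close>

text \<open>With equal boundary terms and f = 0 the energy estimate leaves nothing on the right. It
  gives y = 0 by continuity; then z' = 0, so z is a constant whose integral is the increment of y,
  namely 0.\<close>

lemma hom_sol_trivial:
  assumes sol: "ode_sol {a..b} p (\<lambda>x. 0) y z" and ab: "a < b"
    and \<sigma>: "\<bar>\<sigma>\<bar> = 1" and pos: "AE x in lebesgue. \<delta> \<le> \<sigma> * Im (p x)" and \<delta>: "\<delta> > 0"
    and bdry: "Im (z b * cnj (y b)) = Im (z a * cnj (y a))"
    and s: "s \<in> {a..b}"
  shows "y s = 0" "z s = 0"
proof -
  have y: "ac_deriv {a..b} y z" and z: "ac_deriv {a..b} z (\<lambda>x. p x * y x)"
    using sol by (simp_all add: ode_sol_def)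
  have cy: "continuous_on {a..b} y" by (rule ac_deriv_continuous[OF y])
  have cont: "continuous_on {a..b} (\<lambda>x. (cmod (y x))\<^sup>2)" by (intro continuous_intros cy)
  have "\<delta> * integral {a..b} (\<lambda>x. (cmod (y x))\<^sup>2) \<le> 0"
    using energy_estimate[OF sol _ _ \<sigma> pos] ab bdry by simp
  then have "integral {a..b} (\<lambda>x. (cmod (y x))\<^sup>2) \<le> 0"
    using \<delta> by (simp add: mult_le_0_iff)
  moreover have "0 \<le> integral {a..b} (\<lambda>x. (cmod (y x))\<^sup>2)"
    by (intro Henstock_Kurzweil_Integration.integral_nonneg integrable_continuous_real cont) simp
  ultimately have "integral {a..b} (\<lambda>x. (cmod (y x))\<^sup>2) = 0" by linarith
  then have y0: "y x = 0" if "x \<in> {a..b}" for x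
    using integral_eq_0_iff[OF cont ab] that by simp
  then show "y s = 0" using s by simp
  have "ac_deriv {a..b} z (\<lambda>x. 0)"
    by (rule ac_deriv_cong[OF z]) (use y0 in auto)
  then have zc: "z x = z a" if "x \<in> {a..b}" for x
    using ac_deriv_integral[of "{a..b}" z "\<lambda>x. 0" a x] that by simp
  have "ac_deriv {a..b} y (\<lambda>x. z a)"
    by (rule ac_deriv_cong[OF y]) (auto intro!: zc[symmetric])
  then have "(b - a) *\<^sub>R z a = 0"
    using ac_deriv_integral[of "{a..b}" y "\<lambda>x. z a" a b] ab y0[of a] y0[of b] by simp
  then show "z s = 0" using zc[OF s] ab by simp
qed

section \<open>Elements of L2 on an interval: norm, linear combinations, local integrability\<close>

lemma L2_measurable: "f \<in> L2 I \<Longrightarrow> (\<lambda>x. indicator I x *\<^sub>R f x) \<in> borel_measurable lebesgue"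
  by (simp add: L2_def set_borel_measurable_def)

lemma L2_integrable: "f \<in> L2 I \<Longrightarrow> (\<lambda>x. (cmod (f x))\<^sup>2) absolutely_integrable_on I"
  by (simp add: L2_def)

lemma L2_integrable_on: "f \<in> L2 I \<Longrightarrow> (\<lambda>x. (cmod (f x))\<^sup>2) integrable_on I"
  by (rule set_lebesgue_integral_eq_integral(1)[OF L2_integrable])

lemma L2_norm_eq: "f \<in> L2 I \<Longrightarrow> L2_norm I f = sqrt (integral I (\<lambda>x. (cmod (f x))\<^sup>2))"
  unfolding L2_norm_def by (subst set_lebesgue_integral_eq_integral(2)[OF L2_integrable]) auto

lemma L2_norm_nonneg: "f \<in> L2 I \<Longrightarrow> 0 \<le> L2_norm I f"
  by (auto simp: L2_norm_eq intro!: Henstock_Kurzweil_Integration.integral_nonneg L2_integrable_on)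

lemma L2_norm_power2: "f \<in> L2 I \<Longrightarrow> (L2_norm I f)\<^sup>2 = integral I (\<lambda>x. (cmod (f x))\<^sup>2)"
  by (auto simp: L2_norm_eq intro!: Henstock_Kurzweil_Integration.integral_nonneg L2_integrable_on)

lemma L2I:
  assumes "(\<lambda>x. indicator I x *\<^sub>R f x) \<in> borel_measurable lebesgue"
    and "(\<lambda>x. (cmod (f x))\<^sup>2) integrable_on I"
  shows "f \<in> L2 I"
  using assms nonnegative_absolutely_integrable_1[OF assms(2)]
  by (simp add: L2_def set_borel_measurable_def)

lemma L2_lincomb:
  assumes f: "f \<in> L2 I" and g: "g \<in> L2 I"
  shows "(\<lambda>x. c * f x + d * g x) \<in> L2 I"
proof -
  have "(\<lambda>x. c * (indicator I x *\<^sub>R f x) + d * (indicator I x *\<^sub>R g x)) \<in> borel_measurable lebesgue"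
    by (intro borel_measurable_add borel_measurable_times borel_measurable_const L2_measurable f g)
  moreover have "(\<lambda>x. c * (indicator I x *\<^sub>R f x) + d * (indicator I x *\<^sub>R g x)) =
      (\<lambda>x. indicator I x *\<^sub>R (c * f x + d * g x))"
    by (auto simp: indicator_def algebra_simps)
  ultimately have m: "(\<lambda>x. indicator I x *\<^sub>R (c * f x + d * g x)) \<in> borel_measurable lebesgue" by simp
  have "integrable lebesgue (\<lambda>x. indicator I x *\<^sub>R (2 * (cmod c)\<^sup>2 * (cmod (f x))\<^sup>2 + 2 * (cmod d)\<^sup>2 * (cmod (g x))\<^sup>2))"
    using set_integral_add(1)[OF set_integrable_mult_right[OF L2_integrable[OF f]] set_integrable_mult_right[OF L2_integrable[OF g]], of "2 * (cmod c)\<^sup>2" "2 * (cmod d)\<^sup>2"]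
    by (simp add: set_integrable_def)
  moreover have "(\<lambda>x. (cmod (indicator I x *\<^sub>R (c * f x + d * g x)))\<^sup>2) \<in> borel_measurable lebesgue"
    using m by measurable
  then have "(\<lambda>x. indicator I x *\<^sub>R (cmod (c * f x + d * g x))\<^sup>2) \<in> borel_measurable lebesgue"
    by (rule back_subst[where P="\<lambda>h. h \<in> borel_measurable lebesgue"]) (auto simp: indicator_def)
  ultimately have "integrable lebesgue (\<lambda>x. indicator I x *\<^sub>R (cmod (c * f x + d * g x))\<^sup>2)"
  proof (rule Bochner_Integration.integrable_bound, intro AE_I2)
    fix x
    have "(cmod (c * f x + d * g x))\<^sup>2 \<le> (cmod c * cmod (f x) + cmod d * cmod (g x))\<^sup>2"
      by (intro power_mono) (metis norm_mult norm_triangle_ineq, simp)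
    also have "\<dots> \<le> 2 * (cmod c * cmod (f x))\<^sup>2 + 2 * (cmod d * cmod (g x))\<^sup>2"
      by (smt (verit) power2_sum sum_squares_bound)
    finally show "norm (indicator I x *\<^sub>R (cmod (c * f x + d * g x))\<^sup>2)
        \<le> norm (indicator I x *\<^sub>R (2 * (cmod c)\<^sup>2 * (cmod (f x))\<^sup>2 + 2 * (cmod d)\<^sup>2 * (cmod (g x))\<^sup>2))"
      by (auto simp: indicator_def power_mult_distrib)
  qed
  then show ?thesis
    using m by (simp add: L2_def set_integrable_def set_borel_measurable_def)
qed

lemma L2_diff: "f \<in> L2 I \<Longrightarrow> g \<in> L2 I \<Longrightarrow> (\<lambda>x. f x - g x) \<in> L2 I"
  using L2_lincomb[of f I g 1 "-1"] by simp

lemma continuous_L2: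
  assumes "continuous_on {a..b} f"
  shows "f \<in> L2 {a..b}"
proof (rule L2I)
  have "f \<in> borel_measurable (lebesgue_on {a..b})"
    by (rule continuous_imp_measurable_on_sets_lebesgue[OF assms]) auto
  then show "(\<lambda>x. indicator {a..b} x *\<^sub>R f x) \<in> borel_measurable lebesgue"
    by (subst (asm) borel_measurable_restrict_space_iff) auto
  show "(\<lambda>x. (cmod (f x))\<^sup>2) integrable_on {a..b}"
    by (intro integrable_continuous_real continuous_intros assms)
qed

lemma L2_imp_absolutely_integrable:
  assumes "f \<in> L2 I" "{a..b} \<subseteq> I"
  shows "f absolutely_integrable_on {a..b}"
proof -
  have "integrable lebesgue (\<lambda>x. indicator {a..b} x *\<^sub>R (1 + (cmod (f x))\<^sup>2))"
    using set_integral_add(1)[OF _ absolutely_integrable_on_subinterval[OF L2_integrable[OF assms(1)] assms(2)], of "\<lambda>x. 1"]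
      absolutely_integrable_on_const[of "{a..b}" "1::real"]
    by (simp add: set_integrable_def)
  moreover have "(\<lambda>x. indicator {a..b} x *\<^sub>R (indicator I x *\<^sub>R f x)) \<in> borel_measurable lebesgue"
    by (intro borel_measurable_scaleR borel_measurable_indicator L2_measurable assms(1)) auto
  then have "(\<lambda>x. indicator {a..b} x *\<^sub>R f x) \<in> borel_measurable lebesgue"
    by (rule back_subst[where P="\<lambda>h. h \<in> borel_measurable lebesgue"]) (use assms(2) in \<open>auto simp: indicator_def of_bool_def fun_eq_iff subset_iff\<close>)
  ultimately have "integrable lebesgue (\<lambda>x. indicator {a..b} x *\<^sub>R f x)"
  proof (rule Bochner_Integration.integrable_bound, intro AE_I2)
    fix x
    have "2 * cmod (f x) \<le> 1 + (cmod (f x))\<^sup>2"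
      using sum_squares_bound[of 1 "cmod (f x)"] by simp
    then have "cmod (f x) \<le> 1 + (cmod (f x))\<^sup>2"
      using norm_ge_zero[of "f x"] by linarith
    then show "norm (indicator {a..b} x *\<^sub>R f x) \<le> norm (indicator {a..b} x *\<^sub>R (1 + (cmod (f x))\<^sup>2))"
      by (auto simp: indicator_def)
  qed
  then show ?thesis by (simp add: set_integrable_def)
qed

lemma L2_norm_eq_0_iff:
  assumes "f \<in> L2 I"
  shows "L2_norm I f = 0 \<longleftrightarrow> (AE x in lebesgue. x \<in> I \<longrightarrow> f x = 0)"
proof -
  have "L2_norm I f = 0 \<longleftrightarrow> (\<integral>x. indicator I x *\<^sub>R (cmod (f x))\<^sup>2 \<partial>lebesgue) = 0"
    by (simp add: L2_norm_def set_lebesgue_integral_def)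
  also have "\<dots> \<longleftrightarrow> (AE x in lebesgue. indicator I x *\<^sub>R (cmod (f x))\<^sup>2 = 0)"
    using L2_integrable[OF assms]
    by (intro integral_nonneg_eq_0_iff_AE) (auto simp: set_integrable_def)
  also have "\<dots> \<longleftrightarrow> (AE x in lebesgue. x \<in> I \<longrightarrow> f x = 0)"
    by (intro AE_cong) (auto simp: indicator_def)
  finally show ?thesis .
qed

text \<open>Cauchy-Schwarz on an interval of length 1, obtained from 2 |f| <= t + |f|^2 / t with the
  optimal t equal to the norm. It bounds the forcing on every unit cell by the single global norm of
  f.\<close>

lemma L2_integral_norm_le:
  assumes f: "f \<in> L2 I" and sub: "{a..a + 1} \<subseteq> I"
  shows "integral {a..a + 1} (\<lambda>x. cmod (f x)) \<le> L2_norm I f"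
proof -
  let ?J = "{a..a + 1}" and ?N = "L2_norm I f"
  have fi: "(\<lambda>x. cmod (f x)) integrable_on ?J"
    using L2_imp_absolutely_integrable[OF f sub] by (simp add: absolutely_integrable_on_def)
  have ff: "(\<lambda>x. (cmod (f x))\<^sup>2) integrable_on ?J"
    using absolutely_integrable_on_subinterval[OF L2_integrable[OF f] sub] by (rule set_lebesgue_integral_eq_integral)
  have le: "integral ?J (\<lambda>x. (cmod (f x))\<^sup>2) \<le> ?N\<^sup>2"
    unfolding L2_norm_power2[OF f] by (intro integral_subset_le sub ff L2_integrable_on f) auto
  have bound: "integral ?J (\<lambda>x. cmod (f x)) \<le> (t + ?N\<^sup>2 / t) / 2" if t: "t > 0" for t
  proof -
    have "integral ?J (\<lambda>x. cmod (f x)) \<le> integral ?J (\<lambda>x. t / 2 + 1 / (2 * t) * (cmod (f x))\<^sup>2)"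
    proof (rule Henstock_Kurzweil_Integration.integral_le[OF fi])
      show "(\<lambda>x. t / 2 + 1 / (2 * t) * (cmod (f x))\<^sup>2) integrable_on ?J"
        by (intro integrable_add integrable_on_mult_right ff integrable_const_ivl)
      fix x
      show "cmod (f x) \<le> t / 2 + 1 / (2 * t) * (cmod (f x))\<^sup>2"
        using sum_squares_bound[of t "cmod (f x)"] t by (simp add: field_simps power2_eq_square)
    qed
    also have "\<dots> = t / 2 + 1 / (2 * t) * integral ?J (\<lambda>x. (cmod (f x))\<^sup>2)"
      unfolding Henstock_Kurzweil_Integration.integral_add[OF integrable_const_ivl integrable_on_mult_right[OF ff]]
      by simp
    also have "\<dots> \<le> t / 2 + 1 / (2 * t) * ?N\<^sup>2"
      using t le by (intro add_left_mono mult_left_mono) auto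
    finally show ?thesis using t by (simp add: field_simps)
  qed
  show ?thesis
  proof (cases "?N = 0")
    \<comment> \<open>The optimal t would be 0 here, so arbitrarily small positive t are used
      instead.\<close>
    case True
    show ?thesis
    proof (rule field_le_epsilon)
      fix e :: real assume "e > 0"
      then show "integral ?J (\<lambda>x. cmod (f x)) \<le> ?N + e" using bound[of e] True by simp
    qed
  next
    case False
    then have N: "?N > 0" using L2_norm_nonneg[OF f] by linarith
    have "integral ?J (\<lambda>x. cmod (f x)) \<le> (?N + ?N\<^sup>2 / ?N) / 2" by (rule bound[OF N])
    also have "\<dots> = ?N" using N by (simp add: power2_eq_square)
    finally show ?thesis .
  qed
qed

text \<open>Young's inequality |f| |y| <= |f|^2 / (2 \<delta>) + \<delta> |y|^2 / 2 is weighted so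
  that exactly half of the left side of the energy estimate is absorbed.\<close>

lemma energy_estimate_L2:
  assumes sol: "ode_sol {a..b} p f y z" and ab: "a \<le> b"
    and f: "f \<in> L2 I" and sub: "{a..b} \<subseteq> I"
    and \<sigma>: "\<bar>\<sigma>\<bar> = 1" and pos: "AE x in lebesgue. \<delta> \<le> \<sigma> * Im (p x)" and \<delta>: "\<delta> > 0"
  shows "integral {a..b} (\<lambda>x. (cmod (y x))\<^sup>2) \<le>
    2 / \<delta> * \<bar>Im (z b * cnj (y b)) - Im (z a * cnj (y a))\<bar> + (L2_norm I f / \<delta>)\<^sup>2"
proof -
  let ?W = "\<bar>Im (z b * cnj (y b)) - Im (z a * cnj (y a))\<bar>" and ?Y = "integral {a..b} (\<lambda>x. (cmod (y x))\<^sup>2)"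
  have fa: "f absolutely_integrable_on {a..b}" by (rule L2_imp_absolutely_integrable[OF f sub])
  have ff: "(\<lambda>x. (cmod (f x))\<^sup>2) integrable_on {a..b}"
    using absolutely_integrable_on_subinterval[OF L2_integrable[OF f] sub] by (rule set_lebesgue_integral_eq_integral)
  have cy: "continuous_on {a..b} y"
    using sol by (auto simp: ode_sol_def intro: ac_deriv_continuous)
  have yy: "(\<lambda>x. (cmod (y x))\<^sup>2) integrable_on {a..b}"
    by (intro integrable_continuous_real continuous_intros cy)
  have fy: "(\<lambda>x. cmod (f x) * cmod (y x)) integrable_on {a..b}"
    using absolutely_integrable_continuous_mult[OF cy fa]
    by (simp add: absolutely_integrable_on_def norm_mult mult.commute)
  have "integral {a..b} (\<lambda>x. cmod (f x) * cmod (y x)) \<le>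
      integral {a..b} (\<lambda>x. 1 / (2 * \<delta>) * (cmod (f x))\<^sup>2 + \<delta> / 2 * (cmod (y x))\<^sup>2)"
  proof (rule Henstock_Kurzweil_Integration.integral_le[OF fy])
    show "(\<lambda>x. 1 / (2 * \<delta>) * (cmod (f x))\<^sup>2 + \<delta> / 2 * (cmod (y x))\<^sup>2) integrable_on {a..b}"
      by (intro integrable_add integrable_on_mult_right ff yy)
    fix x
    show "cmod (f x) * cmod (y x) \<le> 1 / (2 * \<delta>) * (cmod (f x))\<^sup>2 + \<delta> / 2 * (cmod (y x))\<^sup>2"
      using sum_squares_bound[of "cmod (f x)" "\<delta> * cmod (y x)"] \<delta>
      by (simp add: field_simps power2_eq_square)
  qed
  also have "\<dots> = 1 / (2 * \<delta>) * integral {a..b} (\<lambda>x. (cmod (f x))\<^sup>2) + \<delta> / 2 * ?Y"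
    unfolding Henstock_Kurzweil_Integration.integral_add[OF integrable_on_mult_right[OF ff] integrable_on_mult_right[OF yy]]
    by simp
  also have "\<dots> \<le> 1 / (2 * \<delta>) * (L2_norm I f)\<^sup>2 + \<delta> / 2 * ?Y"
    unfolding L2_norm_power2[OF f] using \<delta>
    by (intro add_right_mono mult_left_mono integral_subset_le sub ff L2_integrable_on f) auto
  finally have "\<delta> * ?Y \<le> ?W + (1 / (2 * \<delta>) * (L2_norm I f)\<^sup>2 + \<delta> / 2 * ?Y)"
    using energy_estimate[OF sol ab fa \<sigma> pos] by linarith
  then show ?thesis using \<delta> by (simp add: field_simps power2_eq_square)
qed

text \<open>The second derivative is determined only almost everywhere, so the equality of classes
  in the operator graph can be moved into it; the integrated equation then holds with the given
  representative f itself.\<close>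

lemma shift_op_schroedinger_iff:
  assumes "is_interval I"
  shows "(y, f) \<in> shift_op (schroedinger_op I bc q) l \<longleftrightarrow>
    y \<in> L2 I \<and> f \<in> L2 I \<and> (\<exists>z. ode_sol I (\<lambda>x. q x - l) f y z \<and> bc y z)"
proof
  assume "(y, f) \<in> shift_op (schroedinger_op I bc q) l"
  then obtain g where f: "f = (\<lambda>x. g x - l * y x)" and "(y, g) \<in> schroedinger_op I bc q"
    unfolding shift_op_def by (elim CollectE exE conjE Pair_inject) simp
  then obtain y' y'' where *: "y \<in> L2 I" "g \<in> L2 I" "ac_deriv I y y'" "ac_deriv I y' y''" "bc y y'"
    "eq_ae I g (\<lambda>x. - y'' x + q x * y x)"
    unfolding schroedinger_op_def by (elim CollectE case_prodE exE conjE Pair_inject) simp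
  have "AE x in lebesgue. x \<in> I \<longrightarrow> (q x - l) * y x - f x = y'' x"
    using *(6) unfolding eq_ae_def by eventually_elim (auto simp: f algebra_simps)
  from ac_deriv_cong_AE[OF *(4) assms this] have "ode_sol I (\<lambda>x. q x - l) f y y'"
    using *(3) by (simp add: ode_sol_def)
  moreover have "f \<in> L2 I"
    unfolding f using L2_lincomb[OF *(2,1), of 1 "- l"] by simp
  ultimately show "y \<in> L2 I \<and> f \<in> L2 I \<and> (\<exists>z. ode_sol I (\<lambda>x. q x - l) f y z \<and> bc y z)"
    using * by blast
next
  assume "y \<in> L2 I \<and> f \<in> L2 I \<and> (\<exists>z. ode_sol I (\<lambda>x. q x - l) f y z \<and> bc y z)"
  then obtain z where y: "y \<in> L2 I" and fL: "f \<in> L2 I" and sol: "ode_sol I (\<lambda>x. q x - l) f y z" and bc: "bc y z"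
    by (elim conjE exE)
  define g where "g x = f x + l * y x" for x
  have "g \<in> L2 I"
    using L2_lincomb[OF fL y, of 1 l] by (simp add: g_def[abs_def])
  moreover have "eq_ae I g (\<lambda>x. - ((q x - l) * y x - f x) + q x * y x)"
    by (simp add: eq_ae_def g_def algebra_simps)
  ultimately have "(y, g) \<in> schroedinger_op I bc q"
    using y sol bc unfolding schroedinger_op_def ode_sol_def by blast
  moreover have "f = (\<lambda>x. g x - l * y x)" by (simp add: g_def)
  ultimately show "(y, f) \<in> shift_op (schroedinger_op I bc q) l"
    unfolding shift_op_def by blast
qed

text \<open>Injectivity is the estimate applied to differences.\<close>

lemma schroedinger_has_bounded_inverse:
  assumes I: "is_interval I"
    and bc: "\<And>y z u v. bc y z \<Longrightarrow> bc u v \<Longrightarrow> bc (\<lambda>x. y x - u x) (\<lambda>x. z x - v x)"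
    and ex: "\<And>f. f \<in> L2 I \<Longrightarrow> \<exists>y z. y \<in> L2 I \<and> ode_sol I (\<lambda>x. q x - l) f y z \<and> bc y z"
    and bound: "\<And>f y z. f \<in> L2 I \<Longrightarrow> y \<in> L2 I \<Longrightarrow> ode_sol I (\<lambda>x. q x - l) f y z \<Longrightarrow> bc y z \<Longrightarrow>
      L2_norm I y \<le> C * L2_norm I f"
  shows "has_bounded_inverse I (shift_op (schroedinger_op I bc q) l)"
  unfolding has_bounded_inverse_def shift_op_schroedinger_iff[OF I]
proof (intro conjI allI impI ballI)
  fix y1 f1 y2 f2
  assume 1: "y1 \<in> L2 I \<and> f1 \<in> L2 I \<and> (\<exists>z. ode_sol I (\<lambda>x. q x - l) f1 y1 z \<and> bc y1 z)"
    and 2: "y2 \<in> L2 I \<and> f2 \<in> L2 I \<and> (\<exists>z. ode_sol I (\<lambda>x. q x - l) f2 y2 z \<and> bc y2 z)"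
    and eq: "eq_ae I f1 f2"
  from 1 obtain z1 where z1: "ode_sol I (\<lambda>x. q x - l) f1 y1 z1" "bc y1 z1" by (elim conjE exE)
  from 2 obtain z2 where z2: "ode_sol I (\<lambda>x. q x - l) f2 y2 z2" "bc y2 z2" by (elim conjE exE)
  have L: "y1 \<in> L2 I" "y2 \<in> L2 I" "f1 \<in> L2 I" "f2 \<in> L2 I" using 1 2 by simp_all
  have "ode_sol I (\<lambda>x. q x - l) (\<lambda>x. f1 x - f2 x) (\<lambda>x. y1 x - y2 x) (\<lambda>x. z1 x - z2 x)"
    using ode_sol_lincomb[OF z1(1) z2(1), of 1 "-1"] by simp
  from bound[OF L2_diff[OF L(3,4)] L2_diff[OF L(1,2)] this bc[OF z1(2) z2(2)]]
  have "L2_norm I (\<lambda>x. y1 x - y2 x) \<le> C * L2_norm I (\<lambda>x. f1 x - f2 x)" .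
  moreover have "L2_norm I (\<lambda>x. f1 x - f2 x) = 0"
    unfolding L2_norm_eq_0_iff[OF L2_diff[OF L(3,4)]] using eq unfolding eq_ae_def by eventually_elim simp
  ultimately have "L2_norm I (\<lambda>x. y1 x - y2 x) = 0"
    using L2_norm_nonneg[OF L2_diff[OF L(1,2)]] by simp
  then have "AE x in lebesgue. x \<in> I \<longrightarrow> y1 x - y2 x = 0"
    unfolding L2_norm_eq_0_iff[OF L2_diff[OF L(1,2)]] .
  then show "eq_ae I y1 y2" unfolding eq_ae_def by eventually_elim simp
next
  fix f assume "f \<in> L2 I"
  then show "\<exists>y. y \<in> L2 I \<and> f \<in> L2 I \<and> (\<exists>z. ode_sol I (\<lambda>x. q x - l) f y z \<and> bc y z)"
    using ex by blast
next
  show "\<exists>C. \<forall>y f. y \<in> L2 I \<and> f \<in> L2 I \<and> (\<exists>z. ode_sol I (\<lambda>x. q x - l) f y z \<and> bc y z) \<longrightarrow>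
      L2_norm I y \<le> C * L2_norm I f"
    by (rule exI[of _ C]) (auto intro: bound)
qed

section \<open>Separated boundary conditions on the unit interval\<close>

text \<open>With real coefficients either z is a real multiple of y or y vanishes, so the boundary
  term of the energy identity is zero. The form c y + d z = 0 treats Dirichlet and Neumann
  conditions together.\<close>

lemma robin_Im_eq_0:
  fixes c d :: real
  assumes "c \<noteq> 0 \<or> d \<noteq> 0" "complex_of_real c * y + complex_of_real d * z = 0"
  shows "Im (z * cnj y) = 0"
proof (cases "d = 0")
  case False
  have "z = complex_of_real (- c / d) * y"
    using assms(2) False by (simp add: field_simps add_eq_0_iff)
  then show ?thesis by (simp add: mult.assoc complex_mult_cnj)
next
  case True
  then show ?thesis using assms by simp
qed

text \<open>Shooting from 0: a particular solution with zero data meets the condition at 0, and a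
  multiple of a homogeneous solution that also meets it corrects the condition at 1. This is
  possible because a homogeneous solution meeting both conditions is trivial.\<close>

lemma robin_has_bounded_inverse:
  fixes c d :: real
  assumes cd: "c \<noteq> 0 \<or> d \<noteq> 0" and p: "(\<lambda>x. q x - l) absolutely_integrable_on {0..1}"
    and \<sigma>: "\<bar>\<sigma>\<bar> = 1" and pos: "AE x in lebesgue. \<delta> \<le> \<sigma> * Im (q x - l)" and \<delta>: "\<delta> > 0"
  defines "bc \<equiv> (\<lambda>y z. complex_of_real c * y (0::real) + complex_of_real d * z 0 = 0 \<and>
                        complex_of_real c * y (1::real) + complex_of_real d * z 1 = 0)"
  shows "has_bounded_inverse {0..1} (shift_op (schroedinger_op {0..1} bc q) l)"
proof (rule schroedinger_has_bounded_inverse[where C = "1 / \<delta>"])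
  show "bc (\<lambda>x. y x - u x) (\<lambda>x. z x - v x)" if "bc y z" "bc u v" for y z u v
  proof -
    have "C * (y t - u t) + D * (z t - v t) = (C * y t + D * z t) - (C * u t + D * v t)" for C D and t :: real
      by (simp add: algebra_simps)
    then show ?thesis using that unfolding bc_def by simp
  qed
next
  fix f y z assume f: "f \<in> L2 {0..1}" and y: "y \<in> L2 {0..1}"
    and sol: "ode_sol {0..1} (\<lambda>x. q x - l) f y z" and bc: "bc y z"
  have "Im (z 0 * cnj (y 0)) = 0" "Im (z 1 * cnj (y 1)) = 0"
    using bc robin_Im_eq_0[OF cd] unfolding bc_def by blast+
  then have "integral {0..1} (\<lambda>x. (cmod (y x))\<^sup>2) \<le> (L2_norm {0..1} f / \<delta>)\<^sup>2"
    using energy_estimate_L2[OF sol _ f _ \<sigma> pos \<delta>] by simp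
  then have "(L2_norm {0..1} y)\<^sup>2 \<le> (L2_norm {0..1} f / \<delta>)\<^sup>2"
    by (simp add: L2_norm_power2[OF y])
  then show "L2_norm {0..1} y \<le> 1 / \<delta> * L2_norm {0..1} f"
    using \<delta> L2_norm_nonneg[OF f] power2_le_imp_le[of "L2_norm {0..1} y" "L2_norm {0..1} f / \<delta>"] by simp
next
  fix f :: "real \<Rightarrow> complex" assume f: "f \<in> L2 {0..1}"
  let ?p = "\<lambda>x. q x - l"
  obtain y1 z1 where 1: "ode_sol {0..1} ?p f y1 z1" "y1 0 = 0" "z1 0 = 0"
    using ode_sol_exists[OF _ p L2_imp_absolutely_integrable[OF f], of 0 0] by auto
  \<comment> \<open>The data (d, -c) span the solutions of the condition at 0 and are nonzero
    because c or d is.\<close>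
  obtain u v where uv: "ode_sol {0..1} ?p (\<lambda>x. 0) u v" "u 0 = complex_of_real d" "v 0 = - complex_of_real c"
    using ode_sol_exists[OF _ p, of "\<lambda>x. 0" "complex_of_real d" "- complex_of_real c"] by auto
  let ?b = "complex_of_real c * u 1 + complex_of_real d * v 1"
  have b: "?b \<noteq> 0"
  proof
    assume 0: "?b = 0"
    have "Im (v 1 * cnj (u 1)) = Im (v 0 * cnj (u 0))"
      using robin_Im_eq_0[OF cd 0] robin_Im_eq_0[OF cd, of "u 0" "v 0"] uv by (simp add: mult.commute)
    from hom_sol_trivial[OF uv(1) _ \<sigma> pos \<delta> this, of 0] show False
      using uv cd by simp
  qed
  \<comment> \<open>Chosen to cancel the defect of the particular solution in the condition at
    1.\<close>
  define k where "k = (complex_of_real c * y1 1 + complex_of_real d * z1 1) / ?b"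
  have k: "k * ?b = complex_of_real c * y1 1 + complex_of_real d * z1 1" using b by (simp add: k_def)
  let ?y = "\<lambda>x. y1 x - k * u x" and ?z = "\<lambda>x. z1 x - k * v x"
  have "ode_sol {0..1} ?p f ?y ?z"
    using ode_sol_lincomb[OF 1(1) uv(1), of 1 "- k"] by simp
  moreover have "bc ?y ?z"
    unfolding bc_def using k 1 uv by (simp add: algebra_simps)
  moreover have "?y \<in> L2 {0..1}"
    using calculation(1) continuous_L2[OF ac_deriv_continuous] unfolding ode_sol_def by blast
  ultimately show "\<exists>y z. y \<in> L2 {0..1} \<and> ode_sol {0..1} ?p f y z \<and> bc y z" by blast
qed (rule is_interval_cc)

section \<open>Hyperbolic recurrences over the integers\<close>

text \<open>The bounded solution is the sum over the past, with a n equal to the sum of k^j g (n - 1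
  - j) over j >= 0, dominated by a geometric series.\<close>

lemma forward_recurrence:
  fixes k :: complex and g :: "int \<Rightarrow> complex"
  assumes k: "cmod k < 1" and g: "\<And>n. cmod (g n) \<le> G"
  shows "\<exists>a. \<forall>n. a (n + 1) = k * a n + g n \<and> cmod (a n) \<le> G / (1 - cmod k)"
proof -
  have le: "cmod (k ^ j * g m) \<le> G * cmod k ^ j" for j m
    using mult_left_mono[OF g[of m], of "cmod k ^ j"] by (simp add: norm_mult norm_power mult.commute)
  have geo: "(\<lambda>j. G * cmod k ^ j) sums (G * (1 / (1 - cmod k)))"
    by (intro sums_mult geometric_sums) (use k in simp)
  have sn: "summable (\<lambda>j. cmod (k ^ j * g (h j)))" for h :: "nat \<Rightarrow> int"
    by (rule summable_comparison_test'[OF sums_summable[OF geo]]) (use le in simp)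
  note s = summable_norm_cancel[OF sn]
  define a where "a n = (\<Sum>j. k ^ j * g (n - 1 - int j))" for n
  have "a (n + 1) = k * a n + g n" for n
  proof -
    have "a (n + 1) = (\<Sum>j. k ^ j * g (n - int j))" by (simp add: a_def)
    also have "\<dots> = (\<Sum>j. k ^ Suc j * g (n - int (Suc j))) + g n"
      using suminf_split_head[OF s[of "\<lambda>j. n - int j"]] by simp
    also have "(\<Sum>j. k ^ Suc j * g (n - int (Suc j))) = (\<Sum>j. k * (k ^ j * g (n - 1 - int j)))"
      by (simp add: algebra_simps)
    also have "\<dots> = k * a n" unfolding a_def by (rule suminf_mult[OF s])
    finally show ?thesis .
  qed
  moreover have "cmod (a n) \<le> G / (1 - cmod k)" for n
  proof -
    have "cmod (a n) \<le> (\<Sum>j. cmod (k ^ j * g (n - 1 - int j)))"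
      unfolding a_def by (rule summable_norm[OF sn])
    also have "\<dots> \<le> (\<Sum>j. G * cmod k ^ j)"
      by (rule suminf_le[OF _ sn sums_summable[OF geo]]) (rule le)
    finally show ?thesis using sums_unique[OF geo] by simp
  qed
  ultimately show ?thesis by blast
qed

text \<open>Reversing the index turns the expanding factor 1 / k into the contracting factor k and
  the forcing into - k g (- n - 1), which is still bounded by G. The solution is thus a sum over the
  future.\<close>

lemma backward_recurrence:
  fixes k :: complex and g :: "int \<Rightarrow> complex"
  assumes k: "cmod k < 1" "k \<noteq> 0" and g: "\<And>n. cmod (g n) \<le> G"
  shows "\<exists>a. \<forall>n. a (n + 1) = a n / k + g n \<and> cmod (a n) \<le> G / (1 - cmod k)"
proof -
  have "cmod (- k * g (- n - 1)) \<le> G" for n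
    using mult_mono[of "cmod k" 1 "cmod (g (- n - 1))" G] g[of "- n - 1"] k by (simp add: norm_mult)
  from forward_recurrence[OF k(1), of "\<lambda>n. - k * g (- n - 1)", OF this]
  obtain a where a: "\<And>n. a (n + 1) = k * a n - k * g (- n - 1)" "\<And>n. cmod (a n) \<le> G / (1 - cmod k)"
    by auto
  have "a (- n - 1) = a (- n) / k + g n" for n
    using a(1)[of "- n - 1"] k by (simp add: minus_diff_commute field_simps)
  then show ?thesis using a(2) by (intro exI[of _ "\<lambda>n. a (- n)"]) (simp add: minus_diff_commute)
qed

text \<open>The candidate vectors are the columns of the adjugate of r - M. If they both vanish, M
  is r times the identity and any nonzero vector serves.\<close>

lemma eigenvector_2x2:
  fixes m11 m12 m21 m22 :: "'a::field"
  assumes "r\<^sup>2 - (m11 + m22) * r + (m11 * m22 - m12 * m21) = 0"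
  obtains v1 v2 where "v1 \<noteq> 0 \<or> v2 \<noteq> 0" "m11 * v1 + m12 * v2 = r * v1" "m21 * v1 + m22 * v2 = r * v2"
proof -
  have char: "(r - m11) * (r - m22) = m12 * m21"
    using assms by (simp add: algebra_simps power2_eq_square)
  consider "m12 \<noteq> 0 \<or> r - m11 \<noteq> 0" | "m21 \<noteq> 0 \<or> r - m22 \<noteq> 0" | "m12 = 0" "m21 = 0" "r = m11" "r = m22"
    by fastforce
  then show ?thesis
  proof cases
    case 1
    show ?thesis
      by (rule that[of m12 "r - m11"]) (use 1 char in \<open>auto simp: algebra_simps\<close>)
  next
    case 2
    show ?thesis
      by (rule that[of "r - m22" m21]) (use 2 char in \<open>auto simp: algebra_simps\<close>)
  next
    case 3
    show ?thesis by (rule that[of 1 0]) (use 3 in auto)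
  qed
qed

text \<open>Determinant 1 makes the eigenvalues k and 1 / k, which differ as |k| < 1. In eigenvector
  coordinates the system splits into a contracting component, summed over the past, and an expanding
  one, summed over the future. The constant is chosen before the forcing.\<close>

lemma hyperbolic_recurrence:
  fixes m11 m12 m21 m22 k :: complex
  assumes det: "m11 * m22 - m12 * m21 = 1" and k: "k\<^sup>2 - (m11 + m22) * k + 1 = 0" "cmod k < 1"
  shows "\<exists>C\<ge>0. \<forall>(F1::int \<Rightarrow> complex) F2 B. (\<forall>n. cmod (F1 n) \<le> B \<and> cmod (F2 n) \<le> B) \<longrightarrow>
    (\<exists>a b. \<forall>n. a (n + 1) = m11 * a n + m12 * b n + F1 n \<and> b (n + 1) = m21 * a n + m22 * b n + F2 n \<and>
       cmod (a n) \<le> C * B \<and> cmod (b n) \<le> C * B)"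
proof -
  have k0: "k \<noteq> 0" using k by auto
  have k': "(1 / k)\<^sup>2 - (m11 + m22) * (1 / k) + 1 = 0"
    using k(1) k0 by (simp add: field_simps power2_eq_square)
  have kk': "1 / k \<noteq> k"
  proof
    assume "1 / k = k"
    then have "cmod (k * k) = 1" using k0 by (simp add: field_simps)
    then have "cmod k * cmod k = 1" by (simp add: norm_mult)
    moreover have "cmod k * cmod k \<le> cmod k * 1" using k by (intro mult_left_mono) auto
    ultimately show False using k by simp
  qed
  obtain v1 v2 where v: "v1 \<noteq> 0 \<or> v2 \<noteq> 0" "m11 * v1 + m12 * v2 = k * v1" "m21 * v1 + m22 * v2 = k * v2"
    using eigenvector_2x2[of k m11 m22 m12 m21] k det by auto
  obtain w1 w2 where w: "w1 \<noteq> 0 \<or> w2 \<noteq> 0" "m11 * w1 + m12 * w2 = 1 / k * w1" "m21 * w1 + m22 * w2 = 1 / k * w2"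
    using eigenvector_2x2[of "1 / k" m11 m22 m12 m21] k' det by metis
  define D where "D = v1 * w2 - v2 * w1"
  have D: "D \<noteq> 0"
  proof
    assume "D = 0"
    then have eq: "v1 * w2 = v2 * w1" by (simp add: D_def)
    obtain t where t: "w1 = t * v1" "w2 = t * v2"
    proof (cases "v1 = 0")
      case True
      then have "v2 \<noteq> 0" "w1 = 0" using v(1) eq by auto
      then show ?thesis using True by (intro that[of "w2 / v2"]) auto
    next
      case False
      then show ?thesis using eq by (intro that[of "w1 / v1"]) (auto simp: field_simps)
    qed
    have "t \<noteq> 0" using w(1) t by auto
    have "t * (k * v1) = 1 / k * (t * v1)" "t * (k * v2) = 1 / k * (t * v2)"
      using w(2,3) unfolding t v(2,3)[symmetric] by (simp_all add: algebra_simps)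
    then have "k * v1 = 1 / k * v1" "k * v2 = 1 / k * v2"
      using \<open>t \<noteq> 0\<close> by (simp_all add: mult.left_commute[of _ t] flip: times_divide_eq_right)
    then have "k = 1 / k" using v(1) by (metis mult_cancel_right)
    then show False using kk' by simp
  qed
  define L where "L = cmod v1 + cmod v2 + cmod w1 + cmod w2"
  have L: "L \<ge> 0" by (simp add: L_def)
  \<comment> \<open>The factor L / |D| bounds the eigenvector coordinates of the forcing, 1 / (1 -
    |k|) the scalar recurrences, and the outer L the return to the original coordinates.\<close>
  define C where "C = L * (L / cmod D / (1 - cmod k))"
  show ?thesis
  proof (intro exI[of _ C] conjI allI impI)
    show "C \<ge> 0" using L k by (simp add: C_def)
    fix F1 F2 :: "int \<Rightarrow> complex" and B
    assume F: "\<forall>n. cmod (F1 n) \<le> B \<and> cmod (F2 n) \<le> B"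
    have B: "B \<ge> 0" using F order_trans[OF norm_ge_zero] by blast
    \<comment> \<open>Cramer's rule: coordinates of the forcing in the basis of eigenvectors (v1,
      v2) and (w1, w2).\<close>
    define \<alpha> where "\<alpha> n = (F1 n * w2 - F2 n * w1) / D" for n
    define \<beta> where "\<beta> n = (v1 * F2 n - v2 * F1 n) / D" for n
    have lin: "cmod (x * s - y * r) \<le> L * B" if "cmod x \<le> B" "cmod y \<le> B" "cmod s + cmod r \<le> L" for x y s r
    proof -
      have "cmod (x * s - y * r) \<le> cmod x * cmod s + cmod y * cmod r"
        by (metis norm_mult norm_triangle_ineq4)
      also have "\<dots> \<le> B * cmod s + B * cmod r"
        using that by (intro add_mono mult_right_mono) auto
      also have "\<dots> \<le> B * L" unfolding distrib_left[symmetric] using that B by (intro mult_left_mono) auto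
      finally show ?thesis by (simp add: mult.commute)
    qed
    have \<alpha>: "cmod (\<alpha> n) \<le> L / cmod D * B" for n
      using lin[of "F1 n" "F2 n" w2 w1] F D by (simp add: \<alpha>_def norm_divide divide_right_mono L_def)
    have \<beta>: "cmod (\<beta> n) \<le> L / cmod D * B" for n
      using lin[of "F2 n" "F1 n" v1 v2] F D by (simp add: \<beta>_def norm_divide divide_right_mono L_def mult.commute)
    obtain A1 where A1: "\<And>n. A1 (n + 1) = k * A1 n + \<alpha> n" "\<And>n. cmod (A1 n) \<le> L / cmod D * B / (1 - cmod k)"
      using forward_recurrence[OF k(2), of \<alpha>, OF \<alpha>] by blast
    obtain A2 where A2: "\<And>n. A2 (n + 1) = A2 n / k + \<beta> n" "\<And>n. cmod (A2 n) \<le> L / cmod D * B / (1 - cmod k)"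
      using backward_recurrence[OF k(2) k0, of \<beta>, OF \<beta>] by blast
    have dec: "\<alpha> n * v1 + \<beta> n * w1 = F1 n" "\<alpha> n * v2 + \<beta> n * w2 = F2 n" for n
    proof -
      have "(\<alpha> n * v1 + \<beta> n * w1) * D = F1 n * D" "(\<alpha> n * v2 + \<beta> n * w2) * D = F2 n * D"
        using D by (simp_all add: \<alpha>_def \<beta>_def distrib_right) (simp_all add: D_def algebra_simps)
      then show "\<alpha> n * v1 + \<beta> n * w1 = F1 n" "\<alpha> n * v2 + \<beta> n * w2 = F2 n" using D by simp_all
    qed
    have bd: "cmod (A1 n * s + A2 n * r) \<le> C * B" if "cmod s + cmod r \<le> L" for n s r
    proof -
      let ?K = "L / cmod D * B / (1 - cmod k)"
      have K: "?K \<ge> 0" using L B k by simp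
      have "cmod (A1 n * s + A2 n * r) \<le> cmod (A1 n) * cmod s + cmod (A2 n) * cmod r"
        by (metis norm_mult norm_triangle_ineq)
      also have "\<dots> \<le> ?K * cmod s + ?K * cmod r"
        using A1(2) A2(2) by (intro add_mono mult_right_mono) auto
      also have "\<dots> \<le> ?K * L" unfolding distrib_left[symmetric] using that K by (intro mult_left_mono) auto
      finally show ?thesis by (simp add: C_def mult_ac)
    qed
    have "A1 (n + 1) * v1 + A2 (n + 1) * w1 = m11 * (A1 n * v1 + A2 n * w1) + m12 * (A1 n * v2 + A2 n * w2) + F1 n" for n
    proof -
      have "A1 (n + 1) * v1 + A2 (n + 1) * w1 = A1 n * (k * v1) + A2 n * (1 / k * w1) + (\<alpha> n * v1 + \<beta> n * w1)"
        unfolding A1(1) A2(1) by (simp add: algebra_simps)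
      also have "\<dots> = m11 * (A1 n * v1 + A2 n * w1) + m12 * (A1 n * v2 + A2 n * w2) + F1 n"
        unfolding dec v(2)[symmetric] w(2)[symmetric] by (simp add: algebra_simps)
      finally show ?thesis .
    qed
    moreover have "A1 (n + 1) * v2 + A2 (n + 1) * w2 = m21 * (A1 n * v1 + A2 n * w1) + m22 * (A1 n * v2 + A2 n * w2) + F2 n" for n
    proof -
      have "A1 (n + 1) * v2 + A2 (n + 1) * w2 = A1 n * (k * v2) + A2 n * (1 / k * w2) + (\<alpha> n * v2 + \<beta> n * w2)"
        unfolding A1(1) A2(1) by (simp add: algebra_simps)
      also have "\<dots> = m21 * (A1 n * v1 + A2 n * w1) + m22 * (A1 n * v2 + A2 n * w2) + F2 n"
        unfolding dec v(3)[symmetric] w(3)[symmetric] by (simp add: algebra_simps)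
      finally show ?thesis .
    qed
    ultimately show "\<exists>a b. \<forall>n. a (n + 1) = m11 * a n + m12 * b n + F1 n \<and> b (n + 1) = m21 * a n + m22 * b n + F2 n \<and>
       cmod (a n) \<le> C * B \<and> cmod (b n) \<le> C * B"
      by (intro exI[of _ "\<lambda>n. A1 n * v1 + A2 n * w1"] exI[of _ "\<lambda>n. A1 n * v2 + A2 n * w2"] allI conjI bd)
        (simp_all add: L_def)
  qed
qed

section \<open>The line: dissipative Hill equations\<close>

lemma ode_sol_UNIV_continuous:
  assumes "ode_sol UNIV p f y z"
  shows "continuous_on UNIV y"
proof (rule continuous_at_imp_continuous_on, rule ballI)
  fix x :: real
  have "continuous_on {x - 1..x + 1} y"
    using assms ac_deriv_continuous[OF ac_deriv_mono] unfolding ode_sol_def by blast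
  then show "isCont y x"
    by (rule continuous_on_interior) simp
qed

lemma ode_sol_UNIV_iff: "ode_sol UNIV p f y z \<longleftrightarrow> (\<forall>a b. ode_sol {a..b} p f y z)"
  unfolding ode_sol_def ac_deriv_UNIV_iff by blast

lemma ode_sol_UNIV_of_int:
  assumes "\<And>n::int. ode_sol {of_int n..of_int n + 1} p f y z"
  shows "ode_sol UNIV p f y z"
proof -
  have sym: "ode_sol {- real m..real m} p f y z" for m
  proof (induction m)
    case 0
    show ?case by (rule ode_sol_mono[OF assms[of 0]]) simp
  next
    case (Suc m)
    have "ode_sol {- real m - 1..- real m} p f y z" using assms[of "- int m - 1"] by simp
    from ode_sol_glue[OF this Suc] have "ode_sol {- real m - 1..real m} p f y z" by simp
    moreover have "ode_sol {real m..real m + 1} p f y z" using assms[of "int m"] by simp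
    ultimately have "ode_sol {- real m - 1..real m + 1} p f y z" by (rule ode_sol_glue) auto
    moreover have "- real (Suc m) = - real m - 1" "real (Suc m) = real m + 1" by simp_all
    ultimately show ?case by (simp only:)
  qed
  show ?thesis unfolding ode_sol_UNIV_iff
  proof (intro allI)
    fix a b :: real
    obtain m where m: "max \<bar>a\<bar> \<bar>b\<bar> \<le> real m" using real_arch_simple by blast
    show "ode_sol {a..b} p f y z" by (rule ode_sol_mono[OF sym[of m]]) (use m in auto)
  qed
qed

text \<open>The integrals over symmetric intervals increase, so a common bound gives integrability
  on the line by monotone convergence; continuity supplies measurability.\<close>

lemma L2_UNIV_I:
  assumes cont: "continuous_on UNIV y"
    and bound: "\<And>m::nat. integral {- real m..real m} (\<lambda>x. (cmod (y x))\<^sup>2) \<le> R"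
  shows "y \<in> L2 UNIV" "(L2_norm UNIV y)\<^sup>2 \<le> R"
proof -
  define h where "h x = (cmod (y x))\<^sup>2" for x
  define g where "g m x = (if x \<in> {- real m..real m} then h x else 0)" for m x
  have "continuous_on {- real m..real m} y" for m
    by (rule continuous_on_subset[OF cont]) simp
  then have hi: "h integrable_on {- real m..real m}" for m
    unfolding h_def by (intro integrable_continuous_real continuous_intros)
  have gi: "g m integrable_on UNIV" for m
    unfolding g_def using hi by (simp only: integrable_restrict_UNIV)
  have gI: "integral UNIV (g m) = integral {- real m..real m} h" for m
    unfolding g_def by (simp only: integral_restrict_UNIV)
  have h0: "0 \<le> h x" for x by (simp add: h_def)
  have "h integrable_on UNIV \<and> (\<lambda>m. integral UNIV (g m)) \<longlonglongrightarrow> integral UNIV h"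
  proof (rule monotone_convergence_increasing)
    show "g m integrable_on UNIV" for m by (rule gi)
    show "g m x \<le> g (Suc m) x" for m x using h0 by (auto simp: g_def)
    show "(\<lambda>m. g m x) \<longlonglongrightarrow> h x" for x
    proof (rule tendsto_eventually)
      obtain k where "\<bar>x\<bar> \<le> real k" using real_arch_simple by blast
      then have "g m x = h x" if "m \<ge> k" for m using that by (auto simp: g_def)
      then show "\<forall>\<^sub>F m in sequentially. g m x = h x"
        unfolding eventually_sequentially by blast
    qed
    show "bounded (range (\<lambda>m. integral UNIV (g m)))"
    proof (rule boundedI)
      fix r assume "r \<in> range (\<lambda>m. integral UNIV (g m))"
      then obtain m where "r = integral {- real m..real m} h" using gI by auto
      moreover have "0 \<le> integral {- real m..real m} h"
        by (intro Henstock_Kurzweil_Integration.integral_nonneg hi h0)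
      ultimately show "norm r \<le> R" using bound[of m] by (simp add: h_def[abs_def])
    qed
  qed
  then have hU: "h integrable_on UNIV" and lim: "(\<lambda>m. integral UNIV (g m)) \<longlonglongrightarrow> integral UNIV h" by auto
  have "y \<in> borel_measurable lebesgue"
    using continuous_imp_measurable_on_sets_lebesgue[OF cont] by (simp add: lebesgue_on_UNIV_eq)
  then show L: "y \<in> L2 UNIV" using hU by (intro L2I) (simp_all add: h_def[abs_def])
  have "integral UNIV h \<le> R"
    by (rule LIMSEQ_le_const2[OF lim]) (use bound gI in \<open>auto simp: h_def[abs_def]\<close>)
  then show "(L2_norm UNIV y)\<^sup>2 \<le> R" by (simp add: L2_norm_power2[OF L] h_def[abs_def])
qed

text \<open>Continuity gives Borel measurability, so integrability may be tested with the
  uncompleted measure, where translation is an affine substitution.\<close>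

lemma L2_UNIV_continuous_iff:
  assumes cont: "continuous_on UNIV g"
  shows "g \<in> L2 UNIV \<longleftrightarrow> integrable lborel (\<lambda>x. (cmod (g x))\<^sup>2)"
proof -
  have m: "(\<lambda>x. (cmod (g x))\<^sup>2) \<in> borel_measurable lborel"
    using borel_measurable_continuous_onI[OF cont] by measurable
  have "g \<in> borel_measurable lebesgue"
    using continuous_imp_measurable_on_sets_lebesgue[OF cont] by (simp add: lebesgue_on_UNIV_eq)
  then show ?thesis
    by (simp add: L2_def set_borel_measurable_def set_integrable_def integrable_completion[OF m])
qed

lemma L2_UNIV_shift:
  assumes "continuous_on UNIV g" "g \<in> L2 UNIV"
  shows "(\<lambda>x. g (x + 1)) \<in> L2 UNIV"
proof -
  have "continuous_on UNIV (\<lambda>x. g (x + 1))"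
    by (rule continuous_on_compose2[OF assms(1)]) (auto intro!: continuous_intros)
  moreover have "integrable lborel (\<lambda>x. (cmod (g (1 + 1 * x)))\<^sup>2)"
    using assms by (intro lborel_integrable_real_affine[where f = "\<lambda>x. (cmod (g x))\<^sup>2"])
      (simp_all add: L2_UNIV_continuous_iff)
  ultimately show ?thesis by (simp add: L2_UNIV_continuous_iff add.commute)
qed

text \<open>Translation by 1 preserves the norm and multiplies it by \<open>cmod c\<close>.\<close>

lemma L2_quasi_periodic_eq_0:
  assumes cont: "continuous_on UNIV g" and L: "g \<in> L2 UNIV"
    and qp: "\<And>x. g (x + 1) = c * g x" and c: "cmod c \<noteq> 1"
  shows "g x = 0"
proof -
  let ?h = "\<lambda>x. (cmod (g x))\<^sup>2"
  have m: "?h \<in> borel_measurable lborel"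
    using borel_measurable_continuous_onI[OF cont] by measurable
  have "(\<integral>x. ?h x \<partial>lborel) = (\<integral>x. ?h (1 + 1 * x) \<partial>lborel)"
    by (subst lborel_integral_real_affine[of 1 ?h 1]) simp_all
  also have "\<dots> = (\<integral>x. (cmod c)\<^sup>2 * ?h x \<partial>lborel)"
  proof (intro Bochner_Integration.integral_cong refl)
    fix x
    have "g (1 + 1 * x) = c * g x" using qp[of x] by (simp only: mult_1 add.commute)
    then show "?h (1 + 1 * x) = (cmod c)\<^sup>2 * ?h x" by (simp add: norm_mult power_mult_distrib)
  qed
  also have "\<dots> = (cmod c)\<^sup>2 * (\<integral>x. ?h x \<partial>lborel)" by simp
  finally have "(1 - (cmod c)\<^sup>2) * (\<integral>x. ?h x \<partial>lborel) = 0" by (simp add: algebra_simps)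
  moreover have "(cmod c)\<^sup>2 \<noteq> 1" using c norm_ge_zero[of c] unfolding power2_eq_1_iff by linarith
  ultimately have "(\<integral>x. ?h x \<partial>lborel) = 0" by simp
  then have "L2_norm UNIV g = 0"
    by (simp add: L2_norm_def set_lebesgue_integral_def integral_completion[OF m])
  then have 0: "integral UNIV ?h = 0" using L2_norm_power2[OF L] by simp
  have ch: "continuous_on {x..x + 1} ?h"
    by (intro continuous_intros continuous_on_subset[OF cont]) simp
  have "integral {x..x + 1} ?h \<le> integral UNIV ?h"
    by (intro integral_subset_le integrable_continuous_real ch L2_integrable_on L) auto
  moreover have "0 \<le> integral {x..x + 1} ?h"
    by (intro Henstock_Kurzweil_Integration.integral_nonneg integrable_continuous_real ch) simp
  ultimately have "integral {x..x + 1} ?h = 0" using 0 by linarith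
  then have "?h x = 0" using integral_eq_0_iff[OF ch] by simp
  then show ?thesis by simp
qed

section \<open>Floquet analysis for periodic dissipative coefficients\<close>

lemma periodic_of_int:
  fixes h :: "real \<Rightarrow> 'a"
  assumes "\<And>x. h (x + 1) = h x"
  shows "h (x + of_int n) = h x"
proof -
  have nat: "h (x + real m) = h x" for x m
  proof (induction m)
    case (Suc m)
    then show ?case using assms[of "x + real m"] by (simp add: add_ac)
  qed simp
  show ?thesis
  proof (cases "n \<ge> 0")
    case True
    then show ?thesis using nat[of x "nat n"] by simp
  next
    case False
    then show ?thesis using nat[of "x + of_int n" "nat (- n)"] by simp
  qed
qed

text \<open>Models p = V(.,l) - l for nonreal l. The sign \<sigma> covers the upper and the lower
  half-plane of l in one argument.\<close>

locale dissipative_hill =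
  fixes p :: "real \<Rightarrow> complex" and \<sigma> \<delta> :: real
  assumes periodic: "p (x + 1) = p x"
    and p_abs_int: "p absolutely_integrable_on {0..1}"
    and sigma: "\<bar>\<sigma>\<bar> = 1"
    and dissipative: "AE x in lebesgue. \<delta> \<le> \<sigma> * Im (p x)"
    and delta: "\<delta> > 0"
begin

lemma periodic_int: "p (x + of_int n) = p x"
  by (rule periodic_of_int) (rule periodic)

lemma sol_shift_int:
  "ode_sol {of_int n..of_int n + 1} p f y z \<longleftrightarrow>
   ode_sol {0..1} p (\<lambda>x. f (x + of_int n)) (\<lambda>x. y (x + of_int n)) (\<lambda>x. z (x + of_int n))"
  using ode_sol_shift[of 0 "of_int n" 1 p f y z] by (simp add: periodic_int add.commute)

lemma p_abs_int_ivl: "p absolutely_integrable_on {of_int n..of_int n + 1}"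
  using absolutely_integrable_shift[where f = p and a = 0 and c = "of_int n" and b = 1] p_abs_int by (simp add: periodic_int add.commute)

text \<open>The columns are the values at 1 of the solutions with data (1, 0) and (0, 1) at 0.
  Periodicity of p makes the same matrix serve every cell, and the Wronskian gives its
  determinant.\<close>

lemma monodromy:
  obtains m11 m12 m21 m22 where "m11 * m22 - m12 * m21 = 1"
    "\<And>n y z. ode_sol {of_int n..of_int n + 1} p (\<lambda>x. 0) y z \<Longrightarrow>
       y (of_int n + 1) = m11 * y (of_int n) + m12 * z (of_int n) \<and>
       z (of_int n + 1) = m21 * y (of_int n) + m22 * z (of_int n)"
proof -
  obtain c c' where c: "ode_sol {0..1} p (\<lambda>x. 0) c c'" "c 0 = 1" "c' 0 = 0"
    using ode_sol_exists[OF _ p_abs_int, of "\<lambda>x. 0" 1 0] by auto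
  obtain s s' where s: "ode_sol {0..1} p (\<lambda>x. 0) s s'" "s 0 = 0" "s' 0 = 1"
    using ode_sol_exists[OF _ p_abs_int, of "\<lambda>x. 0" 0 1] by auto
  show ?thesis
  proof (rule that[of "c 1" "s' 1" "s 1" "c' 1"])
    show "c 1 * s' 1 - s 1 * c' 1 = 1"
      using wronskian_const[OF c(1) s(1)] c s by (simp add: mult.commute)
    fix n :: int and y z assume "ode_sol {of_int n..of_int n + 1} p (\<lambda>x. 0) y z"
    then have 1: "ode_sol {0..1} p (\<lambda>x. 0) (\<lambda>x. y (x + of_int n)) (\<lambda>x. z (x + of_int n))"
      by (simp add: sol_shift_int)
    have 2: "ode_sol {0..1} p (\<lambda>x. 0) (\<lambda>x. y (of_int n) * c x + z (of_int n) * s x)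
       (\<lambda>x. y (of_int n) * c' x + z (of_int n) * s' x)"
      using ode_sol_lincomb[OF c(1) s(1), of "y (of_int n)" "z (of_int n)"] by simp
    show "y (of_int n + 1) = c 1 * y (of_int n) + s 1 * z (of_int n) \<and>
       z (of_int n + 1) = c' 1 * y (of_int n) + s' 1 * z (of_int n)"
      using ode_sol_unique[OF _ p_abs_int 1 2, of 1] c s by (simp add: add.commute mult.commute)
  qed
qed

text \<open>A multiplier of modulus 1 would give a solution for which the boundary terms of the energy
  identity over one period cancel.\<close>

lemma multiplier:
  assumes det: "m11 * m22 - m12 * m21 = 1"
    and M: "\<And>n y z. ode_sol {of_int n..of_int n + 1} p (\<lambda>x. 0) y z \<Longrightarrow>
       y (of_int n + 1) = m11 * y (of_int n) + m12 * z (of_int n) \<and>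
       z (of_int n + 1) = m21 * y (of_int n) + m22 * z (of_int n)"
  obtains k where "k\<^sup>2 - (m11 + m22) * k + 1 = 0" "cmod k < 1" "k \<noteq> 0"
proof -
  let ?t = "m11 + m22"
  define r where "r = (?t + csqrt (?t\<^sup>2 - 4)) / 2"
  have "2 * r = ?t + csqrt (?t\<^sup>2 - 4)"
    unfolding r_def times_divide_eq_right by (rule nonzero_mult_div_cancel_left) simp
  then have s: "2 * r - ?t = csqrt (?t\<^sup>2 - 4)" by (simp only: add_diff_cancel_left')
  have "4 * (r\<^sup>2 - ?t * r + 1) = (2 * r - ?t)\<^sup>2 - (?t\<^sup>2 - 4)"
    by (simp add: power2_eq_square algebra_simps)
  then have "4 * (r\<^sup>2 - ?t * r + 1) = 0" unfolding s by (simp only: power2_csqrt diff_self)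
  then have r: "r\<^sup>2 - ?t * r + 1 = 0" unfolding mult_eq_0_iff by simp
  then have r0: "r \<noteq> 0" by auto
  have "cmod r \<noteq> 1"
  proof
    assume r1: "cmod r = 1"
    obtain v1 v2 where v: "v1 \<noteq> 0 \<or> v2 \<noteq> 0" "m11 * v1 + m12 * v2 = r * v1" "m21 * v1 + m22 * v2 = r * v2"
      using eigenvector_2x2[of r m11 m22 m12 m21] r det by metis
    obtain y z where y: "ode_sol {0..1} p (\<lambda>x. 0) y z" "y 0 = v1" "z 0 = v2"
      using ode_sol_exists[OF _ p_abs_int, of "\<lambda>x. 0" v1 v2] by auto
    have "y 1 = r * v1" "z 1 = r * v2" using M[of 0 y z] y v by simp_all
    then have "z 1 * cnj (y 1) = (r * cnj r) * (z 0 * cnj (y 0))" using y by (simp add: mult_ac)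
    also have "r * cnj r = 1" using r1 by (simp add: complex_norm_square[symmetric])
    finally have "Im (z 1 * cnj (y 1)) = Im (z 0 * cnj (y 0))" by simp
    from hom_sol_trivial[OF y(1) _ sigma dissipative delta this, of 0] show False
      using y v by simp
  qed
  \<comment> \<open>The product of the two multipliers is the determinant 1, so a root of modulus
    above 1 is replaced by its reciprocal.\<close>
  then consider "cmod r < 1" | "cmod r > 1" by linarith
  then show ?thesis
  proof cases
    case 1
    then show ?thesis using that r r0 by blast
  next
    case 2
    have "(1 / r)\<^sup>2 - ?t * (1 / r) + 1 = 0"
      using r r0 by (simp add: field_simps power2_eq_square)
    then show ?thesis using that[of "1 / r"] 2 r0 by (simp add: norm_divide)
  qed
qed

text \<open>Square integrability of d says nothing directly about the boundary terms at distant
  points, so the energy identity is avoided. With S the translation by 1, the characteristic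
  equation of the period map gives (S - 1 / k) (S - k) d = 0 on the whole line, and each factor is
  injective on continuous L2 functions because |k| is not 1.\<close>

lemma hom_sol_L2_eq_0:
  assumes sol: "ode_sol UNIV p (\<lambda>x. 0) d z" and L: "d \<in> L2 UNIV"
  shows "d x = 0"
proof -
  obtain m11 m12 m21 m22 where det: "m11 * m22 - m12 * m21 = 1"
    and M: "\<And>n y z. ode_sol {of_int n..of_int n + 1} p (\<lambda>x. 0) y z \<Longrightarrow>
       y (of_int n + 1) = m11 * y (of_int n) + m12 * z (of_int n) \<and>
       z (of_int n + 1) = m21 * y (of_int n) + m22 * z (of_int n)"
    using monodromy by metis
  obtain k where k: "k\<^sup>2 - (m11 + m22) * k + 1 = 0" "cmod k < 1" "k \<noteq> 0"
    using multiplier[OF det M] by metis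
  let ?t = "m11 + m22"
  have sh: "ode_sol UNIV p (\<lambda>x. 0) (\<lambda>x. y (x + 1)) (\<lambda>x. z (x + 1))" if "ode_sol UNIV p (\<lambda>x. 0) y z" for y z
    using that ode_sol_shift[of _ 1 _ p "\<lambda>x. 0" y z] unfolding ode_sol_UNIV_iff periodic by blast
  note sol1 = sh[OF sol] and sol2 = sh[OF sh[OF sol]]
  \<comment> \<open>Cayley-Hamilton at the integers.\<close>
  have rec: "d (x + 1 + 1) = ?t * d (x + 1) - d x" for x
  proof -
    define w where "w x = (d (x + 1 + 1) - ?t * d (x + 1)) + d x" for x
    define wz where "wz x = (z (x + 1 + 1) - ?t * z (x + 1)) + z x" for x
    let ?n = "\<lfloor>x\<rfloor>"
    have "ode_sol UNIV p (\<lambda>x. 0) w wz"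
    proof -
      have "w = (\<lambda>x. 1 * (1 * d (x + 1 + 1) + (- ?t) * d (x + 1)) + 1 * d x)"
        "wz = (\<lambda>x. 1 * (1 * z (x + 1 + 1) + (- ?t) * z (x + 1)) + 1 * z x)"
        by (simp_all add: w_def wz_def fun_eq_iff algebra_simps)
      moreover have "(\<lambda>x::real. 0 :: complex) = (\<lambda>x. 1 * (1 * 0 + (- ?t) * 0) + 1 * 0)" by simp
      ultimately show ?thesis
        using ode_sol_lincomb[OF ode_sol_lincomb[OF sol2 sol1, of 1 "- ?t"] sol, of 1 1] by (simp only:)
    qed
    \<comment> \<open>The combination w solves the homogeneous equation; once its data at the
      integer below x vanish, uniqueness on that cell transfers the relation from the integer to
      x.\<close>
    then have w: "ode_sol {of_int ?n..of_int ?n + 1} p (\<lambda>x. 0) w wz" by (simp add: ode_sol_UNIV_iff)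
    have zero: "ode_sol {of_int ?n..of_int ?n + 1} p (\<lambda>x. 0) (\<lambda>x. 0) (\<lambda>x. 0)"
      using ode_sol_lincomb[OF w w, of 0 0] by simp
    have d: "ode_sol {of_int m..of_int m + 1} p (\<lambda>x. 0) d z" for m using sol by (simp add: ode_sol_UNIV_iff)
    have d1: "d (of_int ?n + 1) = m11 * d (of_int ?n) + m12 * z (of_int ?n)"
      "z (of_int ?n + 1) = m21 * d (of_int ?n) + m22 * z (of_int ?n)"
      using M[OF d[of ?n]] by auto
    have d2: "d (of_int ?n + 1 + 1) = m11 * d (of_int ?n + 1) + m12 * z (of_int ?n + 1)"
      "z (of_int ?n + 1 + 1) = m21 * d (of_int ?n + 1) + m22 * z (of_int ?n + 1)"
      using M[OF d[of "?n + 1"]] by (auto simp: add.commute)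
    have "w (of_int ?n) = (1 - (m11 * m22 - m12 * m21)) * d (of_int ?n)"
      "wz (of_int ?n) = (1 - (m11 * m22 - m12 * m21)) * z (of_int ?n)"
      unfolding w_def wz_def d2 d1 by (simp_all add: algebra_simps)
    then have "w (of_int ?n) = 0" "wz (of_int ?n) = 0" using det by simp_all
    then have "w x = 0"
      using ode_sol_unique(1)[OF _ p_abs_int_ivl w zero, of x] by simp
    then show ?thesis by (simp add: w_def algebra_simps)
  qed
  have cd: "continuous_on UNIV d" by (rule ode_sol_UNIV_continuous[OF sol])
  \<comment> \<open>The inner factor (S - k) d; since the trace is k + 1 / k, translation multiplies
    it by 1 / k.\<close>
  define v where "v x = d (x + 1) - k * d x" for x
  have "v x = 0" for x
  proof (rule L2_quasi_periodic_eq_0)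
    show "continuous_on UNIV v"
      unfolding v_def using ode_sol_UNIV_continuous[OF sol1] by (intro continuous_intros cd)
    show "v \<in> L2 UNIV"
      using L2_lincomb[OF L2_UNIV_shift[OF cd L] L, of 1 "- k"] by (simp add: v_def[abs_def])
    show "v (x + 1) = 1 / k * v x" for x
    proof -
      have "?t - k = 1 / k" using k by (simp add: field_simps power2_eq_square)
      moreover have "v (x + 1) = (?t - k) * d (x + 1) - d x"
        unfolding v_def rec by (simp add: algebra_simps)
      ultimately have "v (x + 1) = 1 / k * d (x + 1) - d x" by simp
      then show ?thesis using k(3) by (simp add: v_def right_diff_distrib)
    qed
    show "cmod (1 / k) \<noteq> 1" using k(2,3) by (simp add: norm_divide)
  qed
  then have "d (x + 1) = k * d x" for x by (simp add: v_def)
  from L2_quasi_periodic_eq_0[OF cd L this] k(2) show ?thesis by simp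
qed

text \<open>Bounded values of y and y' at the integers suffice: the boundary terms over [-m, m] are
  then bounded uniformly in m, and the energy estimate bounds the integral of |y|^2 uniformly in m.
  No summability of the values is asked for. The constant precedes f.\<close>

lemma exists_L2_solution:
  "\<exists>C. \<forall>f\<in>L2 UNIV. \<exists>y z. y \<in> L2 UNIV \<and> ode_sol UNIV p f y z \<and> L2_norm UNIV y \<le> C * L2_norm UNIV f"
proof -
  obtain m11 m12 m21 m22 where det: "m11 * m22 - m12 * m21 = 1"
    and M: "\<And>n y z. ode_sol {of_int n..of_int n + 1} p (\<lambda>x. 0) y z \<Longrightarrow>
       y (of_int n + 1) = m11 * y (of_int n) + m12 * z (of_int n) \<and>
       z (of_int n + 1) = m21 * y (of_int n) + m22 * z (of_int n)"
    using monodromy by metis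
  obtain k where k: "k\<^sup>2 - (m11 + m22) * k + 1 = 0" "cmod k < 1" "k \<noteq> 0"
    using multiplier[OF det M] by metis
  obtain C2 where C2: "C2 \<ge> 0" "\<forall>(F1::int \<Rightarrow> complex) F2 B. (\<forall>n. cmod (F1 n) \<le> B \<and> cmod (F2 n) \<le> B) \<longrightarrow>
    (\<exists>a b. \<forall>n. a (n + 1) = m11 * a n + m12 * b n + F1 n \<and> b (n + 1) = m21 * a n + m22 * b n + F2 n \<and>
       cmod (a n) \<le> C2 * B \<and> cmod (b n) \<le> C2 * B)"
    using hyperbolic_recurrence[OF det k(1,2)] by (elim exE conjE)
  obtain C1 where C1: "C1 \<ge> 0" "\<forall>f y z s. f absolutely_integrable_on {0..1} \<longrightarrow> ode_sol {0..1} p f y z \<longrightarrow> s \<in> {0..1} \<longrightarrow>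
       cmod (y s) + cmod (z s) \<le> C1 * (cmod (y 0) + cmod (z 0) + integral {0..1} (\<lambda>x. cmod (f x)))"
    using ode_sol_estimate[OF _ p_abs_int] by (auto elim!: exE conjE)
  \<comment> \<open>Two boundary terms, each at most (C2 C1)^2 times the squared norm of f and
    weighted by 2 / \<delta>, together with the term 1 / \<delta>^2 from the energy
    estimate.\<close>
  define C where "C = sqrt (2 / \<delta> * (2 * (C2 * C1)\<^sup>2) + 1 / \<delta>\<^sup>2)"
  have C0: "0 \<le> 2 / \<delta> * (2 * (C2 * C1)\<^sup>2) + 1 / \<delta>\<^sup>2" using delta by simp
  show ?thesis
  proof (intro exI[of _ C] ballI)
    fix f :: "real \<Rightarrow> complex" assume f: "f \<in> L2 UNIV"
    let ?N = "L2_norm UNIV f"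
    have fi: "f absolutely_integrable_on {a..b}" for a b
      by (rule L2_imp_absolutely_integrable[OF f]) simp
    \<comment> \<open>The zero-data solutions on the cells: their end values are the forcing of the
      recurrence for the values at the integers.\<close>
    have "\<exists>P Q. ode_sol {of_int n..of_int n + 1} p f P Q \<and> P (of_int n) = 0 \<and> Q (of_int n) = 0" for n :: int
      by (rule ode_sol_exists[OF _ p_abs_int_ivl fi]) simp
    then obtain P Q where PQ: "\<And>n::int. ode_sol {of_int n..of_int n + 1} p f (P n) (Q n)"
      "\<And>n. P n (of_int n) = 0" "\<And>n. Q n (of_int n) = 0" by metis
    define F1 where "F1 n = P n (of_int n + 1)" for n
    define F2 where "F2 n = Q n (of_int n + 1)" for n
    have "cmod (F1 n) \<le> C1 * ?N \<and> cmod (F2 n) \<le> C1 * ?N" for n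
    proof -
      let ?f = "\<lambda>x. f (x + of_int n)"
      have s: "ode_sol {0..1} p ?f (\<lambda>x. P n (x + of_int n)) (\<lambda>x. Q n (x + of_int n))"
        using PQ(1)[of n] by (simp add: sol_shift_int)
      have "?f absolutely_integrable_on {0..1}"
        using fi absolutely_integrable_shift[where f = f and a = 0 and c = "of_int n" and b = 1] by simp
      from C1(2)[rule_format, OF this s, of 1]
      have "cmod (F1 n) + cmod (F2 n) \<le> C1 * integral {0..1} (\<lambda>x. cmod (?f x))"
        by (simp add: PQ F1_def F2_def add.commute)
      also have "integral {0..1} (\<lambda>x. cmod (?f x)) = integral {of_int n..of_int n + 1} (\<lambda>x. cmod (f x))"
        using integral_shift_real_ivl[of "of_int n" "of_int n" "of_int n + 1" "\<lambda>x. cmod (f x)"] by simp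
      also have "C1 * \<dots> \<le> C1 * ?N"
        using C1 by (intro mult_left_mono L2_integral_norm_le f) auto
      finally show ?thesis using norm_ge_zero[of "F1 n"] norm_ge_zero[of "F2 n"] by linarith
    qed
    then have "\<forall>n. cmod (F1 n) \<le> C1 * ?N \<and> cmod (F2 n) \<le> C1 * ?N" by blast
    from C2(2)[rule_format, of F1 "C1 * ?N" F2, rule_format, OF this[rule_format]]
    obtain a b where ab: "\<And>n. a (n + 1) = m11 * a n + m12 * b n + F1 n" "\<And>n. b (n + 1) = m21 * a n + m22 * b n + F2 n"
      "\<And>n. cmod (a n) \<le> C2 * (C1 * ?N)" "\<And>n. cmod (b n) \<le> C2 * (C1 * ?N)" by blast
    have "\<exists>Y Z. ode_sol {of_int n..of_int n + 1} p f Y Z \<and> Y (of_int n) = a n \<and> Z (of_int n) = b n" for n :: int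
      by (rule ode_sol_exists[OF _ p_abs_int_ivl fi]) simp
    then obtain Y Z where YZ: "\<And>n::int. ode_sol {of_int n..of_int n + 1} p f (Y n) (Z n)"
      "\<And>n. Y n (of_int n) = a n" "\<And>n. Z n (of_int n) = b n" by metis
    \<comment> \<open>Subtracting the zero-data solution leaves a homogeneous one, to which the
      period map applies; the recurrence then says that neighbouring pieces match in value and
      derivative.\<close>
    have end1: "Y n (of_int n + 1) = a (n + 1)" "Z n (of_int n + 1) = b (n + 1)" for n
    proof -
      have "ode_sol {of_int n..of_int n + 1} p (\<lambda>x. 0) (\<lambda>x. Y n x - P n x) (\<lambda>x. Z n x - Q n x)"
        using ode_sol_lincomb[OF YZ(1)[of n] PQ(1)[of n], of 1 "-1"] by simp
      from M[OF this] have "Y n (of_int n + 1) - F1 n = m11 * a n + m12 * b n"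
        "Z n (of_int n + 1) - F2 n = m21 * a n + m22 * b n"
        unfolding F1_def F2_def YZ PQ by simp_all
      then show "Y n (of_int n + 1) = a (n + 1)" "Z n (of_int n + 1) = b (n + 1)"
        unfolding ab diff_eq_eq by simp_all
    qed
    \<comment> \<open>At an integer the floor selects the piece to its right; the matching just
      shown makes this agree with the piece to its left.\<close>
    define y where "y x = Y \<lfloor>x\<rfloor> x" for x
    define z where "z x = Z \<lfloor>x\<rfloor> x" for x
    have "y x = Y n x \<and> z x = Z n x" if "of_int n \<le> x" "x \<le> of_int n + 1" for n x
    proof (cases "x = of_int n + 1")
      case True
      have "y (of_int (n + 1)) = a (n + 1)" "z (of_int (n + 1)) = b (n + 1)"
        unfolding y_def z_def floor_of_int by (rule YZ)+
      then show ?thesis using True end1[of n] by simp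
    next
      case False
      then have "\<lfloor>x\<rfloor> = n" using that by (intro floor_unique) auto
      then show ?thesis by (simp add: y_def z_def)
    qed
    then have "ode_sol {of_int n..of_int n + 1} p f y z" for n :: int
      by (intro ode_sol_cong[OF YZ(1)[of n]]) auto
    then have sol: "ode_sol UNIV p f y z" by (rule ode_sol_UNIV_of_int)
    have yz: "y (of_int n) = a n" "z (of_int n) = b n" for n
      by (simp_all add: y_def z_def YZ)
    have W: "\<bar>Im (z (of_int n) * cnj (y (of_int n)))\<bar> \<le> (C2 * (C1 * ?N))\<^sup>2" for n
    proof -
      have "\<bar>Im (z (of_int n) * cnj (y (of_int n)))\<bar> \<le> cmod (b n) * cmod (a n)"
        using abs_Im_le_cmod[of "b n * cnj (a n)"] by (simp add: yz norm_mult)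
      also have "\<dots> \<le> (C2 * (C1 * ?N)) * (C2 * (C1 * ?N))"
        using ab(3)[of n] ab(4)[of n] by (intro mult_mono) (auto intro: order_trans[OF norm_ge_zero])
      finally show ?thesis by (simp add: power2_eq_square)
    qed
    have "integral {- real m..real m} (\<lambda>x. (cmod (y x))\<^sup>2) \<le> (C * ?N)\<^sup>2" for m
    proof -
      have "ode_sol {- real m..real m} p f y z" using sol by (simp add: ode_sol_UNIV_iff)
      from energy_estimate_L2[OF this _ f _ sigma dissipative delta]
      have "integral {- real m..real m} (\<lambda>x. (cmod (y x))\<^sup>2) \<le>
        2 / \<delta> * \<bar>Im (z (real m) * cnj (y (real m))) - Im (z (- real m) * cnj (y (- real m)))\<bar> + (?N / \<delta>)\<^sup>2"
        by simp
      also have "\<dots> \<le> 2 / \<delta> * (2 * (C2 * (C1 * ?N))\<^sup>2) + (?N / \<delta>)\<^sup>2"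
        using W[of "int m"] W[of "- int m"] delta by (intro add_right_mono mult_left_mono) auto
      also have "\<dots> = (2 / \<delta> * (2 * (C2 * C1)\<^sup>2) + 1 / \<delta>\<^sup>2) * ?N\<^sup>2"
        by (simp add: power2_eq_square algebra_simps)
      also have "\<dots> = (C * ?N)\<^sup>2" unfolding power_mult_distrib[of C] by (simp only: C_def real_sqrt_pow2[OF C0])
      finally show ?thesis .
    qed
    note R = L2_UNIV_I[OF ode_sol_UNIV_continuous[OF sol] this]
    have "0 \<le> C * ?N" using C0 L2_norm_nonneg[OF f] by (simp add: C_def)
    from power2_le_imp_le[OF R(2) this]
    show "\<exists>y z. y \<in> L2 UNIV \<and> ode_sol UNIV p f y z \<and> L2_norm UNIV y \<le> C * ?N"
      using sol R(1) by blast
  qed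
qed

end

text \<open>The norm bound is known only for the constructed solution. Any other L2 solution differs
  from it by a homogeneous L2 solution, which vanishes.\<close>

lemma line_has_bounded_inverse:
  assumes "dissipative_hill (\<lambda>x. q x - l) \<sigma> \<delta>"
  shows "has_bounded_inverse UNIV (shift_op (schroedinger_op UNIV (\<lambda>y z. True) q) l)"
proof -
  interpret dissipative_hill "\<lambda>x. q x - l" \<sigma> \<delta> by fact
  obtain C where C: "\<forall>f\<in>L2 UNIV. \<exists>y z. y \<in> L2 UNIV \<and> ode_sol UNIV (\<lambda>x. q x - l) f y z \<and>
      L2_norm UNIV y \<le> C * L2_norm UNIV f"
    using exists_L2_solution by blast
  show ?thesis
  proof (rule schroedinger_has_bounded_inverse[where C = C])
    fix f :: "real \<Rightarrow> complex" assume f: "f \<in> L2 UNIV"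
    then show "\<exists>y z. y \<in> L2 UNIV \<and> ode_sol UNIV (\<lambda>x. q x - l) f y z \<and> True" using C by blast
    fix y z assume y: "y \<in> L2 UNIV" and sol: "ode_sol UNIV (\<lambda>x. q x - l) f y z"
    from C f obtain u v where u: "u \<in> L2 UNIV" "ode_sol UNIV (\<lambda>x. q x - l) f u v" "L2_norm UNIV u \<le> C * L2_norm UNIV f"
      by blast
    have "ode_sol UNIV (\<lambda>x. q x - l) (\<lambda>x. 0) (\<lambda>x. y x - u x) (\<lambda>x. z x - v x)"
      using ode_sol_lincomb[OF sol u(2), of 1 "-1"] by simp
    from hom_sol_L2_eq_0[OF this L2_diff[OF y u(1)]] have "y = u" by auto
    then show "L2_norm UNIV y \<le> C * L2_norm UNIV f" using u(3) by simp
  qed auto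
qed

section \<open>The spectra are real\<close>

text \<open>\<open>g \<mapsto> g / (g - 2 i Y)\<close> maps the half-plane \<open>Im g < Y\<close> to the unit disc, so Schwarz's lemma applies.\<close>

lemma Borel_Caratheodory_Im:
  assumes hol: "f holomorphic_on ball c R" and R: "R > 0" and real: "f c \<in> \<real>"
    and X: "\<And>w. w \<in> ball c R \<Longrightarrow> \<bar>Im (f w)\<bar> \<le> X" and z: "z \<in> ball c R"
  shows "(R - cmod (z - c)) * \<bar>Im (f z)\<bar> \<le> 2 * cmod (z - c) * X"
proof -
  have X0: "X \<ge> 0" using X[of c] R by (simp add: order_trans[OF abs_ge_zero])
  define r where "r = cmod (z - c)"
  have r: "0 \<le> r" "r < R" using z by (simp_all add: r_def dist_norm norm_minus_commute)
  \<comment> \<open>Taking Y strictly above X keeps Im g strictly below Y, so the denominator g - 2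
    i Y has no zero in the disc. The case Y = X follows by a limit.\<close>
  have bound: "(R - r) * \<bar>Im (f z)\<bar> \<le> 2 * r * Y" if Y: "Y > X" for Y
  proof -
    have Y0: "Y > 0" using Y X0 by simp
    define g where "g w = f (c + of_real R * w) - f c" for w
    define d where "d w = g w - 2 * \<i> * of_real Y" for w
    have in_ball: "c + of_real R * w \<in> ball c R" if "cmod w < 1" for w
      using that R by (simp add: dist_norm norm_mult)
    have Img: "\<bar>Im (g w)\<bar> < Y" if "cmod w < 1" for w
      using X[OF in_ball[OF that]] Y real by (auto simp: g_def complex_is_Real_iff)
    have lt: "cmod (g w) < cmod (d w)" if w: "cmod w < 1" for w
    proof -
      \<comment> \<open>The points 0 and 2 i Y are mirror images in the line Im = Y, so below this
        line g is closer to 0 than to 2 i Y.\<close>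
      have "(cmod (d w))\<^sup>2 - (cmod (g w))\<^sup>2 = 4 * Y * (Y - Im (g w))"
        unfolding cmod_power2 d_def by (simp add: power2_eq_square algebra_simps)
      also have "\<dots> > 0" using Y0 Img[OF w] by simp
      finally have "(cmod (g w))\<^sup>2 < (cmod (d w))\<^sup>2" by simp
      then show ?thesis by (rule power2_less_imp_less) simp
    qed
    have d0: "d w \<noteq> 0" if "cmod w < 1" for w using lt[OF that] by auto
    have "g holomorphic_on ball 0 1"
      unfolding g_def
      by (intro holomorphic_intros holomorphic_on_compose_gen[OF _ hol, unfolded o_def])
        (use in_ball in auto)
    then have hol': "(\<lambda>w. g w / d w) holomorphic_on ball 0 1"
      unfolding d_def using d0 by (intro holomorphic_intros) (auto simp: d_def)
    have Schwarz: "cmod (g w / d w) \<le> cmod w" if "cmod w < 1" for w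
    proof (rule Schwarz_Lemma(1)[OF hol' _ _ that])
      show "g 0 / d 0 = 0" by (simp add: g_def)
      show "cmod (g w / d w) < 1" if "cmod w < 1" for w
        using lt[OF that] d0[OF that] by (simp add: norm_divide)
    qed
    define w where "w = (z - c) / of_real R"
    have w: "cmod w = r / R" "cmod w < 1" using r R by (simp_all add: w_def norm_divide r_def)
    have "cmod (g w) \<le> cmod w * cmod (d w)"
      using Schwarz[OF w(2)] d0[OF w(2)] by (simp add: norm_divide divide_simps)
    also have "\<dots> \<le> cmod w * (cmod (g w) + 2 * Y)"
      using norm_triangle_ineq4[of "g w" "2 * \<i> * of_real Y"] Y0
      by (intro mult_left_mono) (auto simp: d_def norm_mult)
    finally have "R * cmod (g w) \<le> R * (r / R * (cmod (g w) + 2 * Y))"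
      using R unfolding w(1) by (intro mult_left_mono) auto
    also have "\<dots> = r * (cmod (g w) + 2 * Y)" using R by simp
    finally have le: "(R - r) * cmod (g w) \<le> 2 * r * Y" by (simp add: algebra_simps)
    have "Im (f z) = Im (g w)"
      using real R by (simp add: g_def w_def complex_is_Real_iff)
    then have "(R - r) * \<bar>Im (f z)\<bar> \<le> (R - r) * cmod (g w)"
      using abs_Im_le_cmod[of "g w"] r by (intro mult_left_mono) auto
    then show ?thesis using le by linarith
  qed
  have "((\<lambda>Y. 2 * r * Y) \<longlongrightarrow> 2 * r * X) (at_right X)" by (intro tendsto_intros)
  moreover have "\<forall>\<^sub>F Y in at_right X. (R - r) * \<bar>Im (f z)\<bar> \<le> 2 * r * Y"
    using eventually_at_right_less by (rule eventually_mono) (rule bound)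
  ultimately have "(R - r) * \<bar>Im (f z)\<bar> \<le> 2 * r * X"
    by (rule tendsto_lowerbound) (rule trivial_limit_at_right_real)
  then show ?thesis by (simp add: r_def)
qed

text \<open>\<open>2 - sqrt 3 < 0.27\<close>: when \<open>\<bar>Im l\<bar>\<close> is at least \<open>0.3 \<rho>\<close> the hypothesis suffices, otherwise
  use the disc of radius \<open>\<rho>\<close> about \<open>Re l\<close>.\<close>

lemma abs_Im_potential_le:
  assumes hol: "AE x in lebesgue. V x holomorphic_on D \<and> (\<forall>l\<in>D \<inter> \<real>. V x l \<in> \<real>)"
    and per: "\<And>l x. l \<in> D \<Longrightarrow> V (x + 1) l = V x l"
    and fin: "xi V (D \<inter> half_plane a) < \<infinity>"
    and sub: "complex_prod {a<..} {- rho V (D \<inter> half_plane a)<..<rho V (D \<inter> half_plane a)} \<subseteq> D"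
    and l: "l \<in> D" "l \<in> half_plane (a + rho V (D \<inter> half_plane a))"
  shows "AE x in lebesgue. \<bar>Im (V x l)\<bar> \<le> 9 / 10 * \<bar>Im l\<bar>"
proof -
  define \<Omega> where "\<Omega> = D \<inter> half_plane a"
  define X where "X = enn2real (xi V \<Omega>)"
  define \<rho> where "\<rho> = rho V \<Omega>"
  have X0: "X \<ge> 0" by (simp add: X_def)
  have Q01: "\<bar>Im (V x m)\<bar> \<le> X" if "x \<in> {0..1}" "m \<in> \<Omega>" for x m
  proof -
    have "ennreal \<bar>Im (V x m)\<bar> \<le> xi V \<Omega>"
      unfolding xi_def using that by (intro SUP_upper2[of "(x, m)"]) auto
    also have "xi V \<Omega> = ennreal X" using fin by (simp add: X_def \<Omega>_def)
    finally show ?thesis using X0 by (simp add: ennreal_le_iff)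
  qed
  \<comment> \<open>The supremum in \<open>xi\<close> runs over one period; periodicity extends the
    bound to every real x.\<close>
  have Q: "\<bar>Im (V x m)\<bar> \<le> X" if "m \<in> \<Omega>" for x m
  proof -
    have "V (frac x + of_int \<lfloor>x\<rfloor>) m = V (frac x) m"
      by (rule periodic_of_int) (use that per \<Omega>_def in auto)
    then have "V x m = V (frac x) m" by (simp add: frac_def)
    moreover have "frac x \<in> {0..1}" using frac_lt_1[of x] by simp
    ultimately show ?thesis using Q01[OF _ that] by simp
  qed
  have s3: "1.73 < sqrt 3" "sqrt 3 < 2"
    by (rule real_less_rsqrt, simp add: power2_eq_square) (rule real_less_lsqrt; simp)
  have X\<rho>: "X = (2 - sqrt 3) * \<rho>" using s3 by (simp add: \<rho>_def rho_def X_def)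
  have \<rho>0: "\<rho> \<ge> 0" using s3 X0 by (simp add: \<rho>_def rho_def X_def)
  have X27: "X \<le> 0.27 * \<rho>" unfolding X\<rho> using s3 \<rho>0 by (intro mult_right_mono) auto
  have Rel: "Re l > a + \<rho>" using l(2) by (simp add: half_plane_def \<rho>_def \<Omega>_def)
  have l\<Omega>: "l \<in> \<Omega>" using l(1) Rel \<rho>0 by (simp add: \<Omega>_def half_plane_def)
  show ?thesis
  proof (cases "\<bar>Im l\<bar> \<ge> 0.3 * \<rho>")
    case True
    then have "X \<le> 9 / 10 * \<bar>Im l\<bar>" using X27 by simp
    from order_trans[OF Q[OF l\<Omega>] this] show ?thesis by (rule AE_I2)
  next
    case False
    then have \<rho>: "\<rho> > 0" using \<rho>0 by auto
    let ?B = "ball (of_real (Re l)) \<rho>"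
    \<comment> \<open>The disc is admissible on two counts: Re l > a + \<rho> keeps it to the right
      of a, and radius \<rho> keeps it inside the strip contained in D.\<close>
    have B: "w \<in> \<Omega>" if "w \<in> ?B" for w
    proof -
      have *: "cmod (w - of_real (Re l)) < \<rho>" using that by (simp add: dist_norm norm_minus_commute)
      have re: "a < Re w" using abs_Re_le_cmod[of "w - of_real (Re l)"] * Rel by simp
      have "- \<rho> < Im w" "Im w < \<rho>" using abs_Im_le_cmod[of "w - of_real (Re l)"] * by simp_all
      with re have "w \<in> complex_prod {a<..} {- \<rho><..<\<rho>}"
        unfolding complex_prod_def by (intro CollectI exI[of _ "Re w"] exI[of _ "Im w"]) simp
      then have "w \<in> D" using subsetD[OF sub] by (simp add: \<rho>_def \<Omega>_def)
      then show ?thesis using re by (simp add: \<Omega>_def half_plane_def)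
    qed
    have BD: "?B \<subseteq> D" using B by (auto simp: \<Omega>_def)
    have c: "complex_of_real (Re l) \<in> D \<inter> \<real>" using subsetD[OF BD, of "of_real (Re l)"] \<rho> by simp
    have lc: "cmod (l - of_real (Re l)) = \<bar>Im l\<bar>" by (simp add: cmod_def)
    have lB: "l \<in> ?B" using lc False \<rho> by (simp add: dist_norm norm_minus_commute)
    show ?thesis
      using hol
    proof eventually_elim
      case (elim x)
      have h: "V x holomorphic_on ?B"
        using elim BD by (blast intro: holomorphic_on_subset)
      have v: "V x (of_real (Re l)) \<in> \<real>" using elim c by blast
      have "(\<rho> - \<bar>Im l\<bar>) * \<bar>Im (V x l)\<bar> \<le> 2 * \<bar>Im l\<bar> * X"
        by (rule Borel_Caratheodory_Im[OF h \<rho> v _ lB, unfolded lc]) (rule Q[OF B])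
      also have "\<dots> \<le> 2 * \<bar>Im l\<bar> * (0.27 * \<rho>)" using X27 by (intro mult_left_mono) auto
      also have "\<dots> = \<rho> * (0.54 * \<bar>Im l\<bar>)" by simp
      finally have 1: "(\<rho> - \<bar>Im l\<bar>) * \<bar>Im (V x l)\<bar> \<le> \<rho> * (0.54 * \<bar>Im l\<bar>)" .
      have "\<rho> * (0.7 * \<bar>Im (V x l)\<bar>) \<le> (\<rho> - \<bar>Im l\<bar>) * \<bar>Im (V x l)\<bar>"
        unfolding mult.assoc[symmetric] using False by (intro mult_right_mono) auto
      with 1 have "\<rho> * (0.7 * \<bar>Im (V x l)\<bar>) \<le> \<rho> * (0.54 * \<bar>Im l\<bar>)" by linarith
      then have "0.7 * \<bar>Im (V x l)\<bar> \<le> 0.54 * \<bar>Im l\<bar>" using \<rho> by simp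
      then show ?case by simp
    qed
  qed
qed

lemma not_in_all_spectra:
  assumes per: "\<And>x. V (x + 1) l = V x l"
    and int: "(\<lambda>x. V x l) absolutely_integrable_on {0..1}"
    and bound: "AE x in lebesgue. \<bar>Im (V x l)\<bar> \<le> 9 / 10 * \<bar>Im l\<bar>" and l: "Im l \<noteq> 0"
  shows "l \<notin> all_spectra D V"
proof -
  \<comment> \<open>As Im (V - l) = Im V - Im l, this sign turns the second term into |Im l|;
    subtracting at most nine tenths of it leaves \<delta>.\<close>
  define \<sigma> where "\<sigma> = - sgn (Im l)"
  define \<delta> where "\<delta> = \<bar>Im l\<bar> / 10"
  have \<sigma>: "\<bar>\<sigma>\<bar> = 1" using l by (simp add: \<sigma>_def abs_sgn_eq)
  have \<delta>: "\<delta> > 0" using l by (simp add: \<delta>_def)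
  have pos: "AE x in lebesgue. \<delta> \<le> \<sigma> * Im (V x l - l)"
    using bound
  proof eventually_elim
    case (elim x)
    have "\<sigma> * Im (V x l - l) = \<sigma> * Im (V x l) + \<bar>Im l\<bar>"
      by (simp add: \<sigma>_def algebra_simps abs_sgn)
    moreover have "\<bar>\<sigma> * Im (V x l)\<bar> \<le> 9 / 10 * \<bar>Im l\<bar>" using elim \<sigma> by (simp add: abs_mult)
    ultimately show ?case unfolding \<delta>_def by linarith
  qed
  have p: "(\<lambda>x. V x l - l) absolutely_integrable_on {0..1}"
    using set_integral_diff(1)[OF int, of "\<lambda>x. l"] absolutely_integrable_on_const[of "{0..1::real}" l] by simp
  have "dissipative_hill (\<lambda>x. V x l - l) \<sigma> \<delta>"
    using per p \<sigma> pos \<delta> by unfold_locales auto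
  then have "regular_point UNIV (H_op V) l"
    unfolding regular_point_def H_op_def by (rule line_has_bounded_inverse)
  moreover have "regular_point {0..1} (T_op V) l"
    \<comment> \<open>The pair (1, 0) is the Dirichlet condition; below, (0, 1) is the Neumann
      condition.\<close>
    using robin_has_bounded_inverse[of 1 0, OF _ p \<sigma> pos \<delta>]
    unfolding regular_point_def T_op_def by simp
  moreover have "regular_point {0..1} (N_op V) l"
    using robin_has_bounded_inverse[of 0 1, OF _ p \<sigma> pos \<delta>]
    unfolding regular_point_def N_op_def by simp
  ultimately show ?thesis by (simp add: all_spectra_def spectrum_in_def)
qed

theorem theorem1p3:
  fixes D :: "complex set" and V :: "real \<Rightarrow> complex \<Rightarrow> complex"
  assumes "open D" and "connected D" and "D \<noteq> {}"
    and "piecewise_smooth_boundary D"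
    and "AE x in lebesgue. V x holomorphic_on D \<and> (\<forall>l\<in>D \<inter> \<real>. V x l \<in> \<real>)"
    and "\<And>l x. l \<in> D \<Longrightarrow> V (x + 1) l = V x l"
    and "\<And>l. l \<in> D \<Longrightarrow> (\<lambda>x. V x l) absolutely_integrable_on {0..1}"
  shows "(\<forall>a. xi V (D \<inter> half_plane a) < \<infinity> \<and>
              complex_prod {a<..} {- rho V (D \<inter> half_plane a)<..<rho V (D \<inter> half_plane a)} \<subseteq> D
            \<longrightarrow> all_spectra D V \<inter> (D \<inter> half_plane (a + rho V (D \<inter> half_plane a)))
                  \<subseteq> complex_of_real ` {a + rho V (D \<inter> half_plane a)<..}) \<and>
         (\<forall>a. half_plane a \<subseteq> D \<and> xi V (half_plane a) < \<infinity>
            \<longrightarrow> all_spectra D V \<inter> half_plane (a + rho V (half_plane a))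
                  \<subseteq> complex_of_real ` {a + rho V (half_plane a)<..})"
proof (intro conjI allI impI subsetI)
  have main: "l \<in> complex_of_real ` {a + rho V (D \<inter> half_plane a)<..}"
    if fin: "xi V (D \<inter> half_plane a) < \<infinity>"
      and sub: "complex_prod {a<..} {- rho V (D \<inter> half_plane a)<..<rho V (D \<inter> half_plane a)} \<subseteq> D"
      and l: "l \<in> all_spectra D V" "l \<in> D" "l \<in> half_plane (a + rho V (D \<inter> half_plane a))" for a l
  proof -
    have "Im l = 0"
    proof (rule ccontr)
      assume "Im l \<noteq> 0"
      have "AE x in lebesgue. \<bar>Im (V x l)\<bar> \<le> 9 / 10 * \<bar>Im l\<bar>"
        using assms(5,6) fin sub l(2,3) by (rule abs_Im_potential_le)
      with assms(6)[OF l(2)] assms(7)[OF l(2)] have "l \<notin> all_spectra D V"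
        using \<open>Im l \<noteq> 0\<close> by (rule not_in_all_spectra)
      then show False using l(1) by simp
    qed
    then have "l = complex_of_real (Re l)" by (simp add: complex_eq_iff)
    moreover have "Re l \<in> {a + rho V (D \<inter> half_plane a)<..}" using l(3) by (simp add: half_plane_def)
    ultimately show ?thesis by (rule image_eqI)
  qed
  show "l \<in> complex_of_real ` {a + rho V (D \<inter> half_plane a)<..}"
    if "xi V (D \<inter> half_plane a) < \<infinity> \<and>
        complex_prod {a<..} {- rho V (D \<inter> half_plane a)<..<rho V (D \<inter> half_plane a)} \<subseteq> D"
      "l \<in> all_spectra D V \<inter> (D \<inter> half_plane (a + rho V (D \<inter> half_plane a)))" for a l
    using that by (intro main) auto
  show "l \<in> complex_of_real ` {a + rho V (half_plane a)<..}"
    if *: "half_plane a \<subseteq> D \<and> xi V (half_plane a) < \<infinity>"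
      "l \<in> all_spectra D V \<inter> half_plane (a + rho V (half_plane a))" for a l
  proof -
    have eq: "D \<inter> half_plane a = half_plane a" using * by blast
    \<comment> \<open>A half-plane contains all its horizontal strips, so the strip condition holds
      and the first claim applies with D cut down to the half-plane.\<close>
    have "complex_prod {a<..} {- rho V (half_plane a)<..<rho V (half_plane a)} \<subseteq> half_plane a"
      by (auto simp: complex_prod_def half_plane_def)
    moreover have "l \<in> D" using * by (auto simp: all_spectra_def spectrum_in_def)
    ultimately show ?thesis using main[of a l, unfolded eq] * by blast
  qed
qed

end
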